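(* Let $\mathbf{k}$ be a field of arbitrary characteristic, let $n \ge 2$ be an integer, and let $h(X) \in \mathbf{k}[X]$ with $h(0) \neq 0$ and $\deg_X(h(X)) < n$. Let $R = \mathbf{k}[X,Y,Z]/(X^nY - Z^2 - h(X)Z)$ and let $x,y,z \in R$ denote the cosets of $X,Y,Z$, respectively. Then the group $\mathrm{Aut}(R)$ of $\mathbf{k}$-algebra automorphisms of $R$ is generated by the following automorphisms: (a) the automorphisms $E_f$, for $f$ a polynomial in one variable over $\mathbf{k}$, given by $E_f(x) = x$, $E_f(y) = y + 2f(x)z + x^n f(x)^2 + f(x)h(x)$, $E_f(z) = z + x^n f(x)$; (b) the automorphism $T$ given by $T(x) = x$, $T(y) = y$, $T(z) = -z - h(x)$; (c) and, whenever $h(x) = h_1(x^m)$ for some polynomial $h_1$ in one variable over $\mathbf{k}$ and some integer $m \ge 0$, the linear automorphisms $L_\mu$ given by $L_\mu(x) = \mu x$, $L_\mu(y) = \mu^{-n}y$, $L_\mu(z) = z$, where $\mu \in \mathbf{k}^*$ is such that $\mu^m = 1$.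
   Context: All rings are commutative with identity; $\mathbf{k}^* = \mathbf{k}\setminus\{0\}$. In (c), $m = 0$ is allowed: this is the case where $h$ is constant, and then $\mu$ may be any element of $\mathbf{k}^*$. The automorphisms in (c) are taken for all $m$ and $h_1$ with $h(x)=h_1(x^m)$. *)

theory Defs
  imports "HOL-Algebra.Algebraic_Closure_Type" "HOL-Algebra.Bij"
begin

text \<open>
  The polynomial ring \<open>k[X,Y,Z]\<close> is the iterated polynomial ring \<open>k[X][Y][Z]\<close>: in
  \<^typ>\<open>'a poly poly poly\<close> the innermost variable is \<open>X\<close>, the middle one \<open>Y\<close> and the
  outermost one \<open>Z\<close>.
\<close>

definition polyX :: "'a::comm_ring_1 poly \<Rightarrow> 'a poly poly poly"
  where "polyX f = [:[:f:]:]"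

definition const3 :: "'a::comm_ring_1 \<Rightarrow> 'a poly poly poly"
  where "const3 c = polyX [:c:]"

definition varX :: "'a::comm_ring_1 poly poly poly"
  where "varX = polyX [:0, 1:]"

definition varY :: "'a::comm_ring_1 poly poly poly"
  where "varY = [:[:0, 1:]:]"

definition varZ :: "'a::comm_ring_1 poly poly poly"
  where "varZ = [:0, 1:]"

definition kXYZ :: "'a::field poly poly poly ring"
  where "kXYZ = ring_of_type_algebra"

definition relI :: "nat \<Rightarrow> 'a::field poly \<Rightarrow> 'a poly poly poly set"
  where "relI n h = PIdl\<^bsub>kXYZ\<^esub> (varX ^ n * varY - varZ ^ 2 - polyX h * varZ)"

definition ringR :: "nat \<Rightarrow> 'a::field poly \<Rightarrow> 'a poly poly poly set ring"
  where "ringR n h = kXYZ Quot relI n h"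

definition cls :: "nat \<Rightarrow> 'a::field poly \<Rightarrow> 'a poly poly poly \<Rightarrow> 'a poly poly poly set"
  where "cls n h p = relI n h +>\<^bsub>kXYZ\<^esub> p"

text \<open>
  As for \<^const>\<open>Bij\<close>, automorphisms are taken to be extensional, so that each of them is
  represented by exactly one HOL function.
\<close>

definition algAut :: "nat \<Rightarrow> 'a::field poly \<Rightarrow> ('a poly poly poly set \<Rightarrow> 'a poly poly poly set) set"
  where "algAut n h = {\<phi> \<in> Bij (carrier (ringR n h)).
           \<phi> \<in> ring_hom (ringR n h) (ringR n h) \<and>
           (\<forall>c. \<phi> (cls n h (const3 c)) = cls n h (const3 c))}"

definition AutR :: "nat \<Rightarrow> 'a::field poly \<Rightarrow> ('a poly poly poly set \<Rightarrow> 'a poly poly poly set) monoid"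
  where "AutR n h = BijGroup (carrier (ringR n h)) \<lparr>carrier := algAut n h\<rparr>"

text \<open>
  \<open>is_aut_with n h \<phi> p q r\<close>: \<open>\<phi>\<close> is a \<open>k\<close>-algebra automorphism of \<open>R\<close> that sends
  \<open>x\<close>, \<open>y\<close>, \<open>z\<close> to \<open>p(x,y,z)\<close>, \<open>q(x,y,z)\<close>, \<open>r(x,y,z)\<close>; the value of a polynomial
  at \<open>(x,y,z)\<close> is its coset.
\<close>

definition is_aut_with ::
    "nat \<Rightarrow> 'a::field poly \<Rightarrow> ('a poly poly poly set \<Rightarrow> 'a poly poly poly set)
     \<Rightarrow> 'a poly poly poly \<Rightarrow> 'a poly poly poly \<Rightarrow> 'a poly poly poly \<Rightarrow> bool"
  where "is_aut_with n h \<phi> p q r \<longleftrightarrow> \<phi> \<in> carrier (AutR n h) \<and>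
           \<phi> (cls n h varX) = cls n h p \<and>
           \<phi> (cls n h varY) = cls n h q \<and>
           \<phi> (cls n h varZ) = cls n h r"

definition is_E where
  "is_E n h f \<phi> \<longleftrightarrow> is_aut_with n h \<phi>
     varX
     (varY + 2 * polyX f * varZ + varX ^ n * polyX f ^ 2 + polyX f * polyX h)
     (varZ + varX ^ n * polyX f)"

definition is_T where
  "is_T n h \<phi> \<longleftrightarrow> is_aut_with n h \<phi> varX varY (- varZ - polyX h)"

definition is_L where
  "is_L n h \<mu> \<phi> \<longleftrightarrow> is_aut_with n h \<phi>
     (const3 \<mu> * varX)
     (const3 (inverse \<mu> ^ n) * varY)
     varZ"

text \<open>
  The scalars admitted for \<open>L\<^sub>\<mu>\<close>. For constant \<open>h\<close> one may take \<open>m = 0\<close>, and then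
  every nonzero \<open>\<mu>\<close> is admissible.
\<close>

definition admissible :: "'a::field poly \<Rightarrow> 'a \<Rightarrow> bool"
  where "admissible h \<mu> \<longleftrightarrow> \<mu> \<noteq> 0 \<and>
           (\<exists>m h1. h = pcompose h1 (Polynomial.monom 1 m) \<and> \<mu> ^ m = 1)"

lemma cring_kXYZ: "cring kXYZ"
  unfolding kXYZ_def by (rule cring_from_type_algebra)

lemma ideal_relI: "ideal (relI n h) kXYZ"
  unfolding relI_def
  by (rule cring.cgenideal_ideal[OF cring_kXYZ]) (simp add: kXYZ_def ring_of_type_algebra_def)

lemma cring_ringR: "cring (ringR n h)"
  unfolding ringR_def by (rule ideal.quotient_is_cring[OF ideal_relI cring_kXYZ])

lemma cls_closed: "cls n h p \<in> carrier (ringR n h)"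
proof -
  interpret ideal "relI n h" kXYZ by (rule ideal_relI)
  have "p \<in> carrier kXYZ"
    by (simp add: kXYZ_def ring_of_type_algebra_def)
  then show ?thesis
    unfolding cls_def ringR_def FactRing_def by (simp add: a_rcosetsI[OF a_subset])
qed

lemma subgroup_algAut: "subgroup (algAut n h) (BijGroup (carrier (ringR n h)))"
proof -
  interpret R: cring "ringR n h" by (rule cring_ringR)
  let ?S = "carrier (ringR n h)"
  show ?thesis
  proof (rule subgroup.intro)
    show "algAut n h \<subseteq> carrier (BijGroup ?S)"
      by (auto simp: algAut_def BijGroup_def)
  next
    fix f g assume "f \<in> algAut n h" "g \<in> algAut n h"
    then have B: "f \<in> Bij ?S" "g \<in> Bij ?S"
      and H: "f \<in> ring_hom (ringR n h) (ringR n h)" "g \<in> ring_hom (ringR n h) (ringR n h)"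
      and C: "\<And>c. f (cls n h (const3 c)) = cls n h (const3 c)"
             "\<And>c. g (cls n h (const3 c)) = cls n h (const3 c)"
      by (auto simp: algAut_def)
    have "compose ?S f g \<in> ring_hom (ringR n h) (ringR n h)"
      by (rule ring_hom_memI)
         (simp_all add: compose_eq ring_hom_closed[OF H(1)] ring_hom_closed[OF H(2)]
            ring_hom_mult[OF H(1)] ring_hom_mult[OF H(2)] ring_hom_add[OF H(1)]
            ring_hom_add[OF H(2)] ring_hom_one[OF H(1)] ring_hom_one[OF H(2)])
    then show "f \<otimes>\<^bsub>BijGroup ?S\<^esub> g \<in> algAut n h"
      using B C by (simp add: algAut_def BijGroup_def compose_Bij compose_eq cls_closed)
  next
    show "\<one>\<^bsub>BijGroup ?S\<^esub> \<in> algAut n h"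
      by (auto simp: algAut_def BijGroup_def id_Bij cls_closed intro!: ring_hom_memI)
  next
    fix f assume f: "f \<in> algAut n h"
    let ?g = "\<lambda>x\<in>?S. inv_into ?S f x"
    from f have B: "f \<in> Bij ?S" and H: "f \<in> ring_hom (ringR n h) (ringR n h)"
      and C: "\<And>c. f (cls n h (const3 c)) = cls n h (const3 c)"
      by (auto simp: algAut_def)
    have inj: "inj_on f ?S" using B by (auto simp: Bij_def bij_betw_def)
    have gf: "inv_into ?S f (f x) = x" if "x \<in> ?S" for x
      by (rule inv_into_f_f[OF inj that])
    have gc: "inv_into ?S f x \<in> ?S" if "x \<in> ?S" for x
      by (rule Bij_inv_into_mem[OF B that])
    have "?g \<in> ring_hom (ringR n h) (ringR n h)"
    proof (rule ring_hom_memI)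
      fix x y assume xy: "x \<in> ?S" "y \<in> ?S"
      show "?g (x \<otimes>\<^bsub>ringR n h\<^esub> y) = ?g x \<otimes>\<^bsub>ringR n h\<^esub> ?g y"
        using xy Bij_inv_into_lemma[of ?S f "\<lambda>x y. x \<otimes>\<^bsub>ringR n h\<^esub> y" x y]
          ring_hom_mult[OF H] B by (simp add: Pi_iff)
      show "?g (x \<oplus>\<^bsub>ringR n h\<^esub> y) = ?g x \<oplus>\<^bsub>ringR n h\<^esub> ?g y"
        using xy Bij_inv_into_lemma[of ?S f "\<lambda>x y. x \<oplus>\<^bsub>ringR n h\<^esub> y" x y]
          ring_hom_add[OF H] B by (simp add: Pi_iff)
    next
      show "?g \<one>\<^bsub>ringR n h\<^esub> = \<one>\<^bsub>ringR n h\<^esub>"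
        using gf[OF R.one_closed] ring_hom_one[OF H] by simp
    qed (simp add: gc)
    moreover have "?g (cls n h (const3 c)) = cls n h (const3 c)" for c
      using gf[OF cls_closed, of "const3 c"] C by (simp add: cls_closed)
    ultimately show "inv\<^bsub>BijGroup ?S\<^esub> f \<in> algAut n h"
      using B by (simp add: inv_BijGroup algAut_def restrict_inv_into_Bij cls_closed)
  qed
qed

lemma group_AutR: "group (AutR n h)"
  unfolding AutR_def
  by (rule subgroup.subgroup_is_group[OF subgroup_algAut group_BijGroup])

end

theory Submission
  imports Defs
begin

text \<open>
  Write \<open>L = k((x))[z]\<close>. Since \<open>x\<^sup>n y = z\<^sup>2 + h(x) z\<close>, sending \<open>y\<close> to
  \<open>(z\<^sup>2 + h(x) z) / x\<^sup>n\<close> identifies \<open>R\<close> with a subring \<open>A\<close> of the domain \<open>L\<close>, free over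
  \<open>k[x]\<close> on the elements \<open>y\<^sup>j\<close> and \<open>y\<^sup>j z\<close>. All arguments about a single automorphism take
  place in \<open>A\<close>.

  The heart of the matter is that an automorphism \<open>\<phi>\<close> maps \<open>x\<close> into \<open>k[x]\<close>. The automorphisms
  \<open>E\<^sub>t\<close>, that is \<open>z \<mapsto> z + x\<^sup>n t\<close> with a parameter \<open>t\<close>, have Taylor coefficients \<open>\<Delta>\<^sub>i\<close> that form
  an iterative higher derivation of \<open>A\<close> annihilating \<open>x\<close>; it replaces a locally nilpotent
  derivation, so that the characteristic does not matter. Conjugating it by \<open>\<phi>\<close> gives a nontrivial
  higher derivation \<open>D\<close> that annihilates \<open>\<phi>(x)\<close>, and the claim follows once every element
  annihilated by such a \<open>D\<close> has \<open>z\<close>-degree \<open>0\<close> (\<open>invariants_have_degree_0\<close>).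

  To see this, order the monomials \<open>x\<^sup>a z\<^sup>b\<close> lexicographically, by \<open>b\<close> first and by \<open>-a\<close>
  second. Let \<open>\<alpha>\<close> be the largest slope at which \<open>D\<close> raises the weight of a leading monomial, and
  let \<open>tdeg r\<close> be the largest \<open>i\<close> for which \<open>D\<^sub>i r\<close> attains weight \<open>wt r + i \<alpha>\<close>. Then \<open>tdeg\<close> is
  additive on products and depends only on the leading monomial of \<open>r\<close>, which up to a scalar is
  that of some \<open>x\<^sup>a y\<^sup>j\<close> or \<open>x\<^sup>a y\<^sup>j z\<close>. An annihilated element of positive \<open>z\<close>-degree would
  force \<open>tdeg y = 0\<close> and \<open>2 tdeg z = n tdeg x > 0\<close>, and a comparison of weights then makes \<open>n\<close> odd,
  say \<open>tdeg x = 2 g\<close> and \<open>tdeg z = n g\<close>. Because \<open>n \<ge> 2\<close>, no value of \<open>tdeg\<close> lies strictly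
  between \<open>0\<close> and \<open>2 g\<close>. But \<open>D\<^sub>i D\<^sub>j\<close> is \<open>i + j choose i\<close> times \<open>D\<^sub>i\<^sub>+\<^sub>j\<close>, so
  an element with \<open>tdeg = m\<close> yields one with \<open>tdeg = i\<close> whenever \<open>m choose i\<close> is nonzero in \<open>k\<close>.
  Hence \<open>2 g choose i\<close> for \<open>0 < i < 2 g\<close> and \<open>n g choose g\<close> would all vanish in \<open>k\<close>, which
  is impossible (\<open>binomials_not_all_vanish\<close>).

  Applied to \<open>\<phi>\<close> and its inverse this gives \<open>\<phi>(x) = \<mu> x + \<nu>\<close>, and then a count of degrees gives
  \<open>\<phi>(z) = a(x) + \<kappa> z\<close>. Comparing coefficients of \<open>z\<close> in the image of the defining relation
  yields \<open>\<nu> = 0\<close> and \<open>x\<^sup>n | a (a + h(\<mu> x))\<close>. As \<open>h(0) \<noteq> 0\<close>, only one of the two factors can be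
  divisible by \<open>x\<close>, and so one of them is divisible by \<open>x\<^sup>n\<close>; with \<open>deg h < n\<close> this leaves
  \<open>\<kappa> = 1\<close> or \<open>\<kappa> = -1\<close>, respectively, and \<open>h(\<mu> x) = h(x)\<close> (\<open>automorphism_normal_form\<close>). These are
  exactly the values of \<open>E\<^sub>f L\<^sub>\<mu>\<close> and \<open>E\<^sub>f L\<^sub>\<mu> T\<close> at \<open>x\<close> and \<open>z\<close>, and an automorphism is
  determined by these two values because \<open>x\<^sup>n\<close> can be cancelled from the relation.
\<close>

section \<open>Degree functions and iterative higher derivations\<close>

locale degree_function =
  fixes w :: "'b::idom \<Rightarrow> 'v::linordered_idom"
  assumes w_mult: "p \<noteq> 0 \<Longrightarrow> q \<noteq> 0 \<Longrightarrow> w (p * q) = w p + w q"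
    and w_add: "p \<noteq> 0 \<Longrightarrow> q \<noteq> 0 \<Longrightarrow> p + q \<noteq> 0 \<Longrightarrow> w (p + q) \<le> max (w p) (w q)"
    and w_of_nat: "of_nat N \<noteq> (0::'b) \<Longrightarrow> w (of_nat N) = 0"
begin

text \<open>
  The zero polynomial has no weight; these two predicates let it lie below every bound, so that
  sums need no case distinction.
\<close>

definition below_eq :: "'v \<Rightarrow> 'b \<Rightarrow> bool" where "below_eq \<kappa> p \<longleftrightarrow> p = 0 \<or> w p \<le> \<kappa>"
definition below :: "'v \<Rightarrow> 'b \<Rightarrow> bool" where "below \<kappa> p \<longleftrightarrow> p = 0 \<or> w p < \<kappa>"

lemma below_eq_0 [simp]: "below_eq \<kappa> 0" and below_0 [simp]: "below \<kappa> 0"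
  by (simp_all add: below_eq_def below_def)

lemma w_one: "w 1 = 0"
  using w_of_nat[of 1] by simp

lemma w_uminus: "w (- p) = w p"
proof (cases "p = 0")
  case False
  have "w (-1) + w (-1) = 0" using w_mult[of "-1" "-1"] w_one by simp
  then have "w (-1) = 0" by simp
  then show ?thesis using w_mult[of "-1" p] False by simp
qed simp

lemma w_power: "p \<noteq> 0 \<Longrightarrow> w (p ^ k) = of_nat k * w p"
  by (induction k) (simp_all add: w_one w_mult algebra_simps)

lemma below_eq_mono: "below_eq \<kappa> p \<Longrightarrow> \<kappa> \<le> \<kappa>' \<Longrightarrow> below_eq \<kappa>' p"
  by (auto simp: below_eq_def)

lemma below_eq_add: "below_eq \<kappa> p \<Longrightarrow> below_eq \<kappa> q \<Longrightarrow> below_eq \<kappa> (p + q)"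
  using w_add[of p q] by (fastforce simp: below_eq_def)

lemma below_add: "below \<kappa> p \<Longrightarrow> below \<kappa> q \<Longrightarrow> below \<kappa> (p + q)"
  using w_add[of p q] by (fastforce simp: below_def)

lemma below_eq_sum: "(\<And>i. i \<in> I \<Longrightarrow> below_eq \<kappa> (f i)) \<Longrightarrow> below_eq \<kappa> (sum f I)"
  by (induction I rule: infinite_finite_induct) (simp_all add: below_eq_add)

lemma below_sum: "(\<And>i. i \<in> I \<Longrightarrow> below \<kappa> (f i)) \<Longrightarrow> below \<kappa> (sum f I)"
  by (induction I rule: infinite_finite_induct) (simp_all add: below_add)

lemma below_eq_mult: "below_eq \<kappa> p \<Longrightarrow> below_eq \<kappa>' q \<Longrightarrow> below_eq (\<kappa> + \<kappa>') (p * q)"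
  by (cases "p = 0"; cases "q = 0") (auto simp: below_eq_def w_mult add_mono)

lemma below_mult: "below \<kappa> p \<Longrightarrow> below_eq \<kappa>' q \<Longrightarrow> below (\<kappa> + \<kappa>') (p * q)"
  by (cases "p = 0"; cases "q = 0") (auto simp: below_def below_eq_def w_mult add_less_le_mono)

lemma below_mult': "below_eq \<kappa> p \<Longrightarrow> below \<kappa>' q \<Longrightarrow> below (\<kappa> + \<kappa>') (p * q)"
  using below_mult[of \<kappa>' q \<kappa> p] by (simp add: ac_simps)

lemma below_of_nat_mult: "below \<kappa> p \<Longrightarrow> below \<kappa> (of_nat N * p)"
  using below_mult'[of 0 "of_nat N" \<kappa> p] w_of_nat[of N]
  by (cases "of_nat N = (0::'b)") (auto simp: below_eq_def)

lemma w_add_below: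
  assumes "p \<noteq> 0" and "below (w p) q"
  shows "p + q \<noteq> 0" and "w (p + q) = w p"
proof -
  consider "q = 0" | "q \<noteq> 0" "w q < w p" using assms by (auto simp: below_def)
  then have "p + q \<noteq> 0 \<and> w (p + q) = w p"
  proof cases
    case 2
    have nz: "p + q \<noteq> 0"
    proof
      assume "p + q = 0"
      then have "p = - q" by (simp add: eq_neg_iff_add_eq_0)
      then show False using 2 w_uminus[of q] by simp
    qed
    have "w (p + q) \<le> w p" using w_add[OF assms(1) 2(1) nz] 2 by simp
    moreover have "w p \<le> max (w (p + q)) (w q)"
      using w_add[of "p + q" "- q"] 2 nz assms(1) by (simp add: w_uminus)
    ultimately show ?thesis using nz 2 by (auto simp: max_def split: if_splits)
  qed (use assms in simp)
  then show "p + q \<noteq> 0" and "w (p + q) = w p" by auto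
qed

text \<open>
  Terms of distinct weights cannot cancel, so the heaviest term is the leading term of the sum.
\<close>

lemma sum_distinct_degrees:
  assumes "finite I" and "I \<noteq> {}" and "\<And>i. i \<in> I \<Longrightarrow> f i \<noteq> 0"
    and "inj_on (\<lambda>i. w (f i)) I"
  obtains j where "j \<in> I" and "sum f I \<noteq> 0" and "w (sum f I) = w (f j)"
    and "below (w (f j)) (sum f (I - {j}))" and "\<And>i. i \<in> I \<Longrightarrow> w (f i) \<le> w (f j)"
proof -
  have fin: "finite ((\<lambda>i. w (f i)) ` I)" and ne: "(\<lambda>i. w (f i)) ` I \<noteq> {}"
    using assms by auto
  obtain j where j: "j \<in> I" "w (f j) = Max ((\<lambda>i. w (f i)) ` I)"
    using Max_in[OF fin ne] by auto
  have le: "w (f i) \<le> w (f j)" if "i \<in> I" for i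
    using Max_ge[OF fin] that j(2) by simp
  have b: "below (w (f j)) (sum f (I - {j}))"
  proof (rule below_sum)
    fix i assume "i \<in> I - {j}"
    then have "w (f i) < w (f j)"
      using le[of i] assms(4) j(1) by (force simp: inj_on_def less_le)
    then show "below (w (f j)) (f i)" by (simp add: below_def)
  qed
  have s: "sum f I = f j + sum f (I - {j})"
    using assms(1) j(1) by (simp add: sum.remove)
  show thesis
    using that[OF j(1) _ _ b le] w_add_below[OF assms(3)[OF j(1)] b] s by simp
qed

end

text \<open>
  The operators \<open>D\<^sub>i\<close> are the coefficients of a ring homomorphism \<open>A \<rightarrow> A[t]\<close> that is the identity
  at \<open>t = 0\<close>; \<open>D_iter\<close> says that this homomorphism is a coaction of the additive group. In
  characteristic \<open>0\<close> one has \<open>D\<^sub>i = D\<^sub>1\<^sup>i / i!\<close> for a locally nilpotent \<open>D\<^sub>1\<close>.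
\<close>

locale iterative_derivation =
  fixes A :: "'b::idom set" and D :: "nat \<Rightarrow> 'b \<Rightarrow> 'b"
  assumes A_add: "r \<in> A \<Longrightarrow> s \<in> A \<Longrightarrow> r + s \<in> A"
    and A_mult: "r \<in> A \<Longrightarrow> s \<in> A \<Longrightarrow> r * s \<in> A"
    and D_closed: "r \<in> A \<Longrightarrow> D i r \<in> A"
    and D_0: "r \<in> A \<Longrightarrow> D 0 r = r"
    and D_add: "r \<in> A \<Longrightarrow> s \<in> A \<Longrightarrow> D i (r + s) = D i r + D i s"
    and D_mult: "r \<in> A \<Longrightarrow> s \<in> A \<Longrightarrow> D k (r * s) = (\<Sum>i\<le>k. D i r * D (k - i) s)"
    and D_iter: "r \<in> A \<Longrightarrow> D i (D j r) = of_nat (i + j choose i) * D (i + j) r"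
    and D_finite: "r \<in> A \<Longrightarrow> finite {i. D i r \<noteq> 0}"

lemma (in iterative_derivation) D_zero: "0 \<in> A \<Longrightarrow> D i 0 = 0"
  using D_add[of 0 0 i] by (metis add_0 add_right_cancel)

text \<open>
  Giving the parameter \<open>t\<close> the weight \<open>-\<alpha>\<close>, the assumption says that \<open>\<Sum>\<^sub>i D\<^sub>i r t\<^sup>i\<close> weighs no
  more than \<open>r\<close>.
\<close>

locale bounded_derivation = degree_function w + iterative_derivation A D
  for w :: "'b::idom \<Rightarrow> 'v::linordered_idom" and A :: "'b set" and D +
  fixes \<alpha> :: 'v
  assumes slope: "r \<in> A \<Longrightarrow> below_eq (w r + of_nat i * \<alpha>) (D i r)"
begin

text \<open>
  The degree in \<open>t\<close> of the leading form of \<open>\<Sum>\<^sub>i D\<^sub>i r t\<^sup>i\<close>. The index \<open>0\<close> always belongs to the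
  set when \<open>r \<noteq> 0\<close>, because \<open>D\<^sub>0 r = r\<close>.
\<close>

definition tdeg :: "'b \<Rightarrow> nat" where
  "tdeg r = Max {i. D i r \<noteq> 0 \<and> w (D i r) = w r + of_nat i * \<alpha>}"

lemma
  assumes "r \<in> A" and "r \<noteq> 0"
  shows tdeg_attained: "D (tdeg r) r \<noteq> 0" "w (D (tdeg r) r) = w r + of_nat (tdeg r) * \<alpha>"
    and below_after_tdeg: "tdeg r < i \<Longrightarrow> below (w r + of_nat i * \<alpha>) (D i r)"
proof -
  let ?S = "{i. D i r \<noteq> 0 \<and> w (D i r) = w r + of_nat i * \<alpha>}"
  have fin: "finite ?S" by (rule finite_subset[OF _ D_finite[OF assms(1)]]) auto
  have "0 \<in> ?S" using assms by (simp add: D_0)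
  then have "tdeg r \<in> ?S" unfolding tdeg_def using Max_in[OF fin] by blast
  then show "D (tdeg r) r \<noteq> 0" "w (D (tdeg r) r) = w r + of_nat (tdeg r) * \<alpha>" by auto
  assume "tdeg r < i"
  then have "i \<notin> ?S" unfolding tdeg_def using Max_ge[OF fin] by fastforce
  then show "below (w r + of_nat i * \<alpha>) (D i r)"
    using slope[OF assms(1), of i] by (auto simp: below_def below_eq_def)
qed

lemma tdeg_eqI:
  assumes "r \<in> A" and "D m r \<noteq> 0" and "w (D m r) = w r + of_nat m * \<alpha>"
    and "\<And>i. m < i \<Longrightarrow> below (w r + of_nat i * \<alpha>) (D i r)"
  shows "tdeg r = m"
  unfolding tdeg_def
proof (rule Max_eqI)
  show "finite {i. D i r \<noteq> 0 \<and> w (D i r) = w r + of_nat i * \<alpha>}"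
    by (rule finite_subset[OF _ D_finite[OF assms(1)]]) auto
  fix i assume i: "i \<in> {i. D i r \<noteq> 0 \<and> w (D i r) = w r + of_nat i * \<alpha>}"
  show "i \<le> m"
  proof (rule ccontr)
    assume "\<not> i \<le> m"
    then show False using assms(4)[of i] i by (auto simp: below_def)
  qed
qed (use assms in auto)

text \<open>
  In the Leibniz sum for \<open>D\<^sub>k (r s)\<close> with \<open>k = tdeg r + tdeg s\<close> exactly one term has full weight;
  for larger \<open>k\<close> there is none.
\<close>

lemma tdeg_mult:
  assumes r: "r \<in> A" "r \<noteq> 0" and s: "s \<in> A" "s \<noteq> 0"
  shows "tdeg (r * s) = tdeg r + tdeg s"
proof (rule tdeg_eqI)
  let ?w = "\<lambda>i. w r + w s + of_nat i * \<alpha>"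
  have b: "below (?w k) (D i r * D (k - i) s)"
    if ik: "i \<le> k" and "tdeg r < i \<or> tdeg s < k - i" for i k
  proof -
    have eq: "?w k = (w r + of_nat i * \<alpha>) + (w s + of_nat (k - i) * \<alpha>)"
      using ik by (simp add: of_nat_diff algebra_simps)
    from that(2) show ?thesis unfolding eq
      using below_mult[OF below_after_tdeg[OF r] slope[OF s(1)]]
        below_mult'[OF slope[OF r(1)] below_after_tdeg[OF s]] by blast
  qed
  let ?m = "tdeg r + tdeg s"
  let ?lead = "D (tdeg r) r * D (tdeg s) s"
  have nz: "?lead \<noteq> 0" and wl: "w ?lead = ?w ?m"
    using tdeg_attained[OF r] tdeg_attained[OF s] by (simp_all add: w_mult algebra_simps)
  have "D ?m (r * s) = ?lead + (\<Sum>i\<in>{..?m} - {tdeg r}. D i r * D (?m - i) s)"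
    by (subst D_mult[OF r(1) s(1)], subst sum.remove[of _ "tdeg r"]) auto
  moreover have "below (w ?lead) (\<Sum>i\<in>{..?m} - {tdeg r}. D i r * D (?m - i) s)"
    unfolding wl by (rule below_sum, rule b) auto
  ultimately have "D ?m (r * s) \<noteq> 0 \<and> w (D ?m (r * s)) = ?w ?m"
    using w_add_below[OF nz] wl by simp
  then show "D ?m (r * s) \<noteq> 0" and "w (D ?m (r * s)) = w (r * s) + of_nat ?m * \<alpha>"
    using r s by (auto simp: w_mult)
  fix k assume "?m < k"
  then have "below (?w k) (D k (r * s))"
    unfolding D_mult[OF r(1) s(1)] by (intro below_sum b) auto
  then show "below (w (r * s) + of_nat k * \<alpha>) (D k (r * s))"
    using r s by (simp add: w_mult)
qed (use r s A_mult in auto)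

lemma tdeg_add_below:
  assumes r: "r \<in> A" "r \<noteq> 0" and s: "s \<in> A" "below (w r) s"
  shows "tdeg (r + s) = tdeg r"
proof (rule tdeg_eqI)
  have w: "w (r + s) = w r" using w_add_below[OF r(2) s(2)] by simp
  have b: "below (w r + of_nat i * \<alpha>) (D i s)" for i
  proof (cases "s = 0")
    case True
    then show ?thesis using D_zero s by simp
  next
    case False
    then show ?thesis using slope[OF s(1), of i] s(2)
      by (auto simp: below_def below_eq_def)
  qed
  show "r + s \<in> A" using r s A_add by auto
  show "D (tdeg r) (r + s) \<noteq> 0" and "w (D (tdeg r) (r + s)) = w (r + s) + of_nat (tdeg r) * \<alpha>"
    using w_add_below[OF tdeg_attained(1)[OF r]] b[of "tdeg r"] tdeg_attained(2)[OF r] w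
    by (simp_all add: D_add r s)
  fix i assume "tdeg r < i"
  then show "below (w (r + s) + of_nat i * \<alpha>) (D i (r + s))"
    unfolding w D_add[OF r(1) s(1)] by (intro below_add b below_after_tdeg[OF r])
qed

lemma tdeg_power_Suc:
  assumes "r \<in> A" and "r \<noteq> 0"
  shows "r ^ Suc k \<in> A \<and> tdeg (r ^ Suc k) = Suc k * tdeg r"
proof (induction k)
  case (Suc k)
  then show ?case
    using tdeg_mult[OF assms, of "r ^ Suc k"] A_mult[OF assms(1), of "r ^ Suc k"] assms by simp
qed (use assms in simp)

lemma tdeg_power:
  assumes "r \<in> A" and "r \<noteq> 0" and "0 < k"
  shows "tdeg (r ^ k) = k * tdeg r"
  using tdeg_power_Suc[OF assms(1,2), of "k - 1"] assms(3) by auto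

text \<open>
  Writing \<open>s = D\<^sub>m\<^sub>-\<^sub>i r\<close> with \<open>m = tdeg r\<close>, iterativity makes \<open>D\<^sub>i s\<close> a nonzero multiple of the
  top coefficient \<open>D\<^sub>m r\<close>. This determines the weight of \<open>s\<close> and shows that \<open>tdeg s\<close> is exactly
  \<open>i\<close>. The case \<open>i = 0\<close> says that the top coefficient itself has \<open>tdeg\<close> zero.
\<close>

lemma tdeg_iterate:
  assumes r: "r \<in> A" "r \<noteq> 0" and i: "i \<le> tdeg r" and bin: "of_nat (tdeg r choose i) \<noteq> (0::'b)"
  defines "s \<equiv> D (tdeg r - i) r"
  shows "s \<noteq> 0" and "w s = w r + of_nat (tdeg r - i) * \<alpha>" and "tdeg s = i"
proof -
  let ?m = "tdeg r"
  have sA: "s \<in> A" unfolding s_def by (rule D_closed[OF r(1)])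
  have Di: "D i s = of_nat (?m choose i) * D ?m r"
    unfolding s_def using D_iter[OF r(1), of i "?m - i"] i by simp
  have nz: "D i s \<noteq> 0" using Di bin tdeg_attained[OF r] by simp
  have wD: "w (D i s) = w r + of_nat ?m * \<alpha>"
    unfolding Di using bin tdeg_attained[OF r] by (simp add: w_mult w_of_nat)
  show s: "s \<noteq> 0" using nz D_zero sA by auto
  have of: "of_nat (?m - i) * \<alpha> = of_nat ?m * \<alpha> - of_nat i * \<alpha>"
    using i by (simp add: of_nat_diff algebra_simps)
  have "w s \<le> w r + of_nat (?m - i) * \<alpha>"
    using slope[OF r(1), of "?m - i"] s unfolding s_def by (simp add: below_eq_def)
  moreover have "w (D i s) \<le> w s + of_nat i * \<alpha>"
    using slope[OF sA, of i] nz by (simp add: below_eq_def)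
  ultimately show ws: "w s = w r + of_nat (?m - i) * \<alpha>"
    using wD of by linarith
  show "tdeg s = i"
  proof (rule tdeg_eqI)
    show "w (D i s) = w s + of_nat i * \<alpha>" unfolding wD ws of by simp
    fix j assume j: "i < j"
    have "below (w r + of_nat (j + (?m - i)) * \<alpha>) (D (j + (?m - i)) r)"
      by (rule below_after_tdeg[OF r]) (use i j in auto)
    then have "below (w r + of_nat (j + (?m - i)) * \<alpha>) (D j s)"
      unfolding s_def D_iter[OF r(1)] by (rule below_of_nat_mult)
    then show "below (w s + of_nat j * \<alpha>) (D j s)"
      unfolding ws by (simp add: algebra_simps)
  qed (use sA nz in auto)
qed

lemma tdeg_ge: "r \<in> A \<Longrightarrow> D i r \<noteq> 0 \<Longrightarrow> w (D i r) = w r + of_nat i * \<alpha> \<Longrightarrow> i \<le> tdeg r"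
  using below_after_tdeg[of r i] D_zero by (cases "r = 0") (auto simp: below_def not_le[symmetric])

lemma tdeg_eq_0: "r \<in> A \<Longrightarrow> r \<noteq> 0 \<Longrightarrow> (\<And>i. 0 < i \<Longrightarrow> D i r = 0) \<Longrightarrow> tdeg r = 0"
  using tdeg_attained(1)[of r] by (metis gr0I)

end

section \<open>Homomorphisms of polynomial rings\<close>

definition is_hom :: "('b::comm_ring_1 \<Rightarrow> 'c::comm_ring_1) \<Rightarrow> bool" where
  "is_hom F \<longleftrightarrow> F 1 = 1 \<and> (\<forall>a b. F (a + b) = F a + F b) \<and> (\<forall>a b. F (a * b) = F a * F b)"

lemma is_homI:
  "F 1 = 1 \<Longrightarrow> (\<And>a b. F (a + b) = F a + F b) \<Longrightarrow> (\<And>a b. F (a * b) = F a * F b) \<Longrightarrow> is_hom F"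
  by (simp add: is_hom_def)

lemma
  assumes "is_hom F"
  shows hom_one: "F 1 = 1" and hom_add: "F (a + b) = F a + F b"
    and hom_mult: "F (a * b) = F a * F b" and hom_zero: "F 0 = 0"
    and hom_uminus: "F (- a) = - F a" and hom_diff: "F (a - b) = F a - F b"
    and hom_power: "F (a ^ k) = F a ^ k" and hom_of_nat: "F (of_nat k) = of_nat k"
    and hom_numeral: "F (numeral m) = numeral m"
proof -
  show 1: "F 1 = 1" and a: "F (a + b) = F a + F b" and m: "F (a * b) = F a * F b" for a b
    using assms by (auto simp: is_hom_def)
  show 0: "F 0 = 0" using a[of 0 0] by (metis add_0 add_right_cancel)
  show u: "F (- a) = - F a" for a using a[of a "- a"] 0 by (simp add: eq_neg_iff_add_eq_0 add.commute)
  show "F (a - b) = F a - F b" using a[of a "- b"] u by simp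
  show "F (a ^ k) = F a ^ k" by (induction k) (simp_all add: 1 m)
  show n: "F (of_nat k) = of_nat k" for k by (induction k) (simp_all add: 0 1 a)
  show "F (numeral m) = numeral m" using n[of "numeral m"] by simp
qed

lemmas hom_simps = hom_one hom_add hom_mult hom_zero hom_uminus hom_diff hom_power
  hom_of_nat hom_numeral

lemma hom_sum: "is_hom F \<Longrightarrow> F (sum g I) = (\<Sum>i\<in>I. F (g i))"
  by (induction I rule: infinite_finite_induct) (simp_all add: hom_simps)

lemma is_hom_comp: "is_hom F \<Longrightarrow> is_hom G \<Longrightarrow> is_hom (\<lambda>p. G (F p))"
  by (simp add: is_hom_def)

lemma is_hom_const_poly: "is_hom (\<lambda>c. [:c:])"
  by (rule is_homI) (simp_all add: one_pCons)

definition peval :: "('b::comm_ring_1 \<Rightarrow> 'c::comm_ring_1) \<Rightarrow> 'c \<Rightarrow> 'b poly \<Rightarrow> 'c" where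
  "peval F a p = poly (map_poly F p) a"

lemma peval_pCons: "is_hom F \<Longrightarrow> peval F a (pCons c p) = F c + a * peval F a p"
  by (simp add: peval_def map_poly_pCons hom_zero)

lemma peval_0: "peval F a 0 = 0"
  by (simp add: peval_def)

lemma peval_const: "is_hom F \<Longrightarrow> peval F a [:c:] = F c"
  by (simp add: peval_pCons peval_0)

lemma peval_X: "is_hom F \<Longrightarrow> peval F a [:0, 1:] = a"
  by (simp add: peval_pCons peval_0 hom_simps)

lemma is_hom_peval:
  assumes F: "is_hom F"
  shows "is_hom (peval F a)"
proof (rule is_homI)
  show "peval F a 1 = 1"
    using peval_const[OF F, of a 1] by (simp add: one_pCons hom_simps[OF F])
  have add: "peval F a (p + q) = peval F a p + peval F a q" for p q
  proof (induction p arbitrary: q)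
    case (pCons c p)
    obtain d q' where q: "q = pCons d q'" by (cases q)
    show ?case unfolding q
      by (simp add: peval_pCons[OF F] hom_simps[OF F] pCons.IH algebra_simps del: pCons_eq_iff)
  qed (simp add: peval_0)
  then show "peval F a (p + q) = peval F a p + peval F a q" for p q .
  have smult: "peval F a (smult c q) = F c * peval F a q" for c q
    by (induction q) (simp_all add: peval_0 peval_pCons[OF F] hom_simps[OF F] algebra_simps)
  show "peval F a (p * q) = peval F a p * peval F a q" for p q
    by (induction p)
      (simp_all add: peval_0 peval_pCons[OF F] add smult hom_simps[OF F] algebra_simps)
qed

lemma peval_eq_sum: "is_hom F \<Longrightarrow> Polynomial.degree p < N \<Longrightarrow> peval F a p = (\<Sum>j<N. F (coeff p j) * a ^ j)"
proof (induction p arbitrary: N)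
  case (pCons c p)
  then obtain M where M: "N = Suc M" by (cases N) auto
  have "p = 0 \<or> Polynomial.degree p < M" using pCons.prems M by (auto split: if_splits)
  then have "peval F a p = (\<Sum>j<M. F (coeff p j) * a ^ j)"
    using pCons.IH pCons.prems by (auto simp: peval_0 hom_zero)
  then show ?case
    unfolding M sum.lessThan_Suc_shift
    by (simp add: peval_pCons[OF pCons.prems(1)] sum_distrib_left algebra_simps)
qed (simp add: peval_0 hom_zero)

lemma poly_hom_ext:
  assumes F: "is_hom F" and G: "is_hom G" and "\<And>c. F [:c:] = G [:c:]" and "F [:0, 1:] = G [:0, 1:]"
  shows "F p = G p"
proof (induction p)
  case (pCons c p)
  have "pCons c p = [:c:] + [:0, 1:] * p" by simp
  then show ?case using pCons assms(3,4) by (simp only: hom_add[OF F] hom_mult[OF F]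
    hom_add[OF G] hom_mult[OF G])
qed (simp add: hom_zero F G)

text \<open>
  The uniqueness half of the universal property of \<open>k[X,Y,Z]\<close>; all identities between
  substitutions are checked with it on the three variables.
\<close>

lemma poly3_hom_ext:
  fixes F G :: "'a::comm_ring_1 poly poly poly \<Rightarrow> 'b::comm_ring_1"
  assumes F: "is_hom F" and G: "is_hom G" and c: "\<And>c. F (const3 c) = G (const3 c)"
    and X: "F varX = G varX" and Y: "F varY = G varY" and Z: "F varZ = G varZ"
  shows "F P = G P"
proof -
  have h1: "is_hom (\<lambda>p::'a poly. [:[:p:]:])"
    by (rule is_hom_comp[OF is_hom_const_poly is_hom_const_poly])
  have 1: "F [:[:p:]:] = G [:[:p:]:]" for p
    by (rule poly_hom_ext[OF is_hom_comp[OF h1 F] is_hom_comp[OF h1 G]])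
      (use c X in \<open>auto simp: const3_def varX_def polyX_def\<close>)
  have 2: "F [:p:] = G [:p:]" for p
    by (rule poly_hom_ext[OF is_hom_comp[OF is_hom_const_poly F] is_hom_comp[OF is_hom_const_poly G]])
      (use 1 Y in \<open>auto simp: varY_def\<close>)
  show ?thesis
    by (rule poly_hom_ext[OF F G]) (use 2 Z in \<open>auto simp: varZ_def\<close>)
qed

section \<open>The surface as a subring of k((x))[z]\<close>

definition emb :: "'a::field poly \<Rightarrow> 'a fls poly" where
  "emb p = [:fps_to_fls (fps_of_poly p):]"

lemma is_hom_emb: "is_hom emb"
  by (rule is_homI)
    (simp_all add: emb_def one_pCons fps_of_poly_add fps_of_poly_mult fls_times_fps_to_fls)

lemmas emb_simps = hom_simps[OF is_hom_emb]

lemma emb_eq_iff [simp]: "emb p = emb q \<longleftrightarrow> p = q"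
  by (simp add: emb_def fps_of_poly_eq_iff)

lemma emb_eq_0_iff [simp]: "emb p = 0 \<longleftrightarrow> p = 0"
  using emb_eq_iff[of p 0] by (simp add: emb_simps del: emb_eq_iff)

lemma degree_emb [simp]: "Polynomial.degree (emb p) = 0"
  by (simp add: emb_def)

lemma emb_X: "emb [:0, 1:] = [:fls_X:]"
  by (simp add: emb_def)

lemma emb_const: "emb [:c:] = [:fls_const c:]"
  by (simp add: emb_def fps_of_poly_const)

lemma emb_monom: "emb (Polynomial.monom c a) = emb [:c:] * [:fls_X:] ^ a"
proof -
  have "Polynomial.monom c a = [:c:] * [:0, 1:] ^ a" by (simp add: monom_altdef)
  then show ?thesis by (simp only: emb_simps emb_X)
qed

text \<open>
  The weight of \<open>x\<^sup>a z\<^sup>b + \<dots>\<close> is the pair \<open>(b, -a)\<close>, ordered lexicographically. The pair is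
  encoded as the polynomial \<open>b X - a\<close>, because the order of \<open>rat poly\<close> treats \<open>X\<close> as infinitely
  large and makes it a linearly ordered domain. Rational coefficients allow slopes to be divided
  by positive integers.
\<close>

definition wt :: "'a::field fls poly \<Rightarrow> rat poly" where
  "wt p = [:- of_int (fls_subdegree (lead_coeff p)), of_nat (Polynomial.degree p):]"

lemma wt_const: "c \<noteq> 0 \<Longrightarrow> wt (emb [:c:]) = 0"
  by (simp add: wt_def emb_const)

lemma lex_le: "[:a, b:] \<le> [:c, d:] \<longleftrightarrow> b < d \<or> b = d \<and> a \<le> (c :: rat)"
  by (auto simp: less_poly_def less_eq_poly_def pos_poly_pCons)

interpretation wt: degree_function "wt :: 'a::field fls poly \<Rightarrow> rat poly"
proof
  fix p q :: "'a fls poly" assume p: "p \<noteq> 0" and q: "q \<noteq> 0"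
  show "wt (p * q) = wt p + wt q"
    using p q unfolding wt_def lead_coeff_mult by (simp add: degree_mult_eq)
  assume pq: "p + q \<noteq> 0"
  consider "Polynomial.degree p < Polynomial.degree q" | "Polynomial.degree q < Polynomial.degree p"
    | "Polynomial.degree p = Polynomial.degree q" by linarith
  then show "wt (p + q) \<le> max (wt p) (wt q)"
  proof cases
    case 1
    then have "wt (p + q) = wt q" by (simp add: wt_def degree_add_eq_right coeff_eq_0)
    then show ?thesis by simp
  next
    case 2
    then have "wt (p + q) = wt p" by (simp add: wt_def degree_add_eq_left coeff_eq_0)
    then show ?thesis by simp
  next
    case 3
    let ?d = "Polynomial.degree p"
    have le: "Polynomial.degree (p + q) \<le> ?d" using degree_add_le[of p ?d q] 3 by simp
    show ?thesis
    proof (cases "Polynomial.degree (p + q) = ?d")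
      case True
      have lc: "lead_coeff (p + q) = lead_coeff p + lead_coeff q" using True 3 by simp
      have "lead_coeff (p + q) \<noteq> 0" using pq leading_coeff_neq_0 by blast
      then have "lead_coeff p + lead_coeff q \<noteq> 0" by (simp only: lc not_False_eq_True)
      then have "min (fls_subdegree (lead_coeff p)) (fls_subdegree (lead_coeff q))
          \<le> fls_subdegree (lead_coeff (p + q))"
        unfolding lc by (rule fls_plus_subdegree)
      then show ?thesis
        unfolding wt_def le_max_iff_disj lex_le using True 3 by (auto simp: min_def split: if_splits)
    next
      case False
      then show ?thesis using le unfolding wt_def le_max_iff_disj lex_le by auto
    qed
  qed
next
  fix N assume nz: "of_nat N \<noteq> (0 :: 'a fls poly)"
  have N: "(of_nat N :: 'a fls poly) = emb [:of_nat N:]"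
    using emb_simps(8)[of N, where 'a = 'a] by (simp add: of_nat_poly)
  have "of_nat N \<noteq> (0 :: 'a)"
  proof
    assume "of_nat N = (0 :: 'a)"
    then have "(of_nat N :: 'a fls poly) = emb [:0:]" by (subst N) (simp only:)
    then show False using nz by simp
  qed
  then show "wt (of_nat N :: 'a fls poly) = 0" by (subst N) (rule wt_const)
qed

lemma wt_X: "wt [:fls_X:] = [:-1, 0:]" and wt_Z: "wt [:0, 1:] = [:0, 1:]"
  by (simp_all add: wt_def)

lemma wt_emb_le: "p \<noteq> 0 \<Longrightarrow> wt (emb p) \<le> 0"
proof -
  assume "p \<noteq> 0"
  have "wt (emb p) \<le> [:0, 0:]" unfolding wt_def lex_le by (simp add: emb_def fls_subdegree_fls_to_fps)
  then show ?thesis by simp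
qed

text \<open>
  The condition \<open>1 \<le> B\<close> keeps the degrees \<open>k * B\<close> distinct.
\<close>

lemma degree_sum_top:
  fixes f :: "nat \<Rightarrow> 'b::idom poly"
  assumes "f K \<noteq> 0" and "Polynomial.degree (f K) = K * B" and "1 \<le> B"
    and "\<And>k. k < K \<Longrightarrow> f k = 0 \<or> Polynomial.degree (f k) = k * B"
  shows "Polynomial.degree (\<Sum>k\<le>K. f k) = K * B"
proof (cases "K = 0")
  case False
  have "Polynomial.degree (\<Sum>k<K. f k) < K * B"
    by (rule degree_sum_less) (use assms False in force)+
  then have "Polynomial.degree ((\<Sum>k<K. f k) + f K) = K * B"
    using assms(2) by (subst degree_add_eq_right) auto
  then show ?thesis by (simp add: lessThan_Suc_atMost[symmetric])
qed (use assms in simp)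

locale danielewski =
  fixes n :: nat and h :: "'a::field poly"
  assumes n2: "2 \<le> n" and h0: "poly h 0 \<noteq> 0" and deg_h: "Polynomial.degree h < n"
begin

abbreviation XX :: "'a fls poly" where "XX \<equiv> [:fls_X:]"
abbreviation ZZ :: "'a fls poly" where "ZZ \<equiv> [:0, 1:]"


text \<open>
  The element \<open>(z\<^sup>2 + h z) / x\<^sup>n\<close>, the only possible image of \<open>y\<close>.
\<close>

definition YY :: "'a fls poly" where
  "YY = [:0, fps_to_fls (fps_of_poly h) * inverse (fls_X ^ n), inverse (fls_X ^ n):]"

lemma h_nz [simp]: "h \<noteq> 0" using h0 by auto

lemma relation: "XX ^ n * YY = ZZ * (ZZ + emb h)"
  by (simp add: YY_def emb_def poly_const_pow algebra_simps)

definition \<iota> :: "'a poly poly poly \<Rightarrow> 'a fls poly" where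
  "\<iota> = peval (peval emb YY) ZZ"

definition A :: "'a fls poly set" where "A = range \<iota>"

definition rel :: "'a poly poly poly" where
  "rel = varX ^ n * varY - varZ ^ 2 - polyX h * varZ"

lemma is_hom_\<iota>: "is_hom \<iota>"
  unfolding \<iota>_def by (intro is_hom_peval is_hom_emb)

lemmas \<iota>_simps = hom_simps[OF is_hom_\<iota>]

lemma \<iota>_polyX: "\<iota> (polyX p) = emb p"
  by (simp add: \<iota>_def polyX_def peval_const is_hom_emb is_hom_peval)

lemma \<iota>_const3: "\<iota> (const3 c) = emb [:c:]"
  by (simp add: const3_def \<iota>_polyX)

lemma \<iota>_varX: "\<iota> varX = XX"
  by (simp add: varX_def \<iota>_polyX emb_X)

lemma \<iota>_varY: "\<iota> varY = YY"
  by (simp add: \<iota>_def varY_def peval_const is_hom_emb is_hom_peval peval_X)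

lemma \<iota>_varZ: "\<iota> varZ = ZZ"
  unfolding \<iota>_def varZ_def by (rule peval_X) (intro is_hom_emb is_hom_peval)

lemma \<iota>_rel: "\<iota> rel = 0"
  using relation by (simp add: rel_def \<iota>_simps \<iota>_varX \<iota>_varY \<iota>_varZ \<iota>_polyX power2_eq_square algebra_simps)

lemma A_emb [simp]: "emb p \<in> A" unfolding A_def using \<iota>_polyX by (metis rangeI)
lemma A_X [simp]: "XX \<in> A" unfolding A_def using \<iota>_varX by (metis rangeI)
lemma A_Y [simp]: "YY \<in> A" unfolding A_def using \<iota>_varY by (metis rangeI)
lemma A_Z [simp]: "ZZ \<in> A" unfolding A_def using \<iota>_varZ by (metis rangeI)
lemma A_add [simp]: "r \<in> A \<Longrightarrow> s \<in> A \<Longrightarrow> r + s \<in> A"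
  unfolding A_def by (auto simp flip: \<iota>_simps)
lemma A_mult [simp]: "r \<in> A \<Longrightarrow> s \<in> A \<Longrightarrow> r * s \<in> A"
  unfolding A_def by (auto simp flip: \<iota>_simps)
lemma A_0 [simp]: "0 \<in> A" and A_1 [simp]: "1 \<in> A" unfolding A_def using \<iota>_simps by (metis rangeI)+
lemma A_diff [simp]: "r \<in> A \<Longrightarrow> s \<in> A \<Longrightarrow> r - s \<in> A"
  unfolding A_def by (auto simp flip: \<iota>_simps)
lemma A_uminus [simp]: "r \<in> A \<Longrightarrow> - r \<in> A"
  unfolding A_def by (auto simp flip: \<iota>_simps)
lemma A_power [simp]: "r \<in> A \<Longrightarrow> r ^ k \<in> A"
  by (induction k) auto
lemma A_sum [simp]: "(\<And>i. i \<in> I \<Longrightarrow> f i \<in> A) \<Longrightarrow> sum f I \<in> A"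
  by (induction I rule: infinite_finite_induct) auto

text \<open>
  Up to sign the relation is monic of degree \<open>2\<close> in \<open>Z\<close>, so division with remainder by it is
  possible over \<open>k[X,Y]\<close>.
\<close>

lemma reduce_mod_rel: "\<exists>Q a b. P = rel * Q + [:a, b:]"
proof (induction P)
  case (pCons c P)
  then obtain Q a b where P: "P = rel * Q + [:a, b:]" by blast
  have X: "varX ^ n = ([:[:[:0, 1:] ^ n:]:] :: 'a poly poly poly)"
    by (simp add: varX_def polyX_def poly_const_pow)
  have "pCons c P = [:c:] + varZ * (rel * Q + ([:a:] + [:b:] * varZ))"
    unfolding P by (simp add: varZ_def)
  also have "\<dots> = rel * (varZ * Q - [:b:]) + ([:c:] + [:a:] * varZ + [:b:] * (varZ ^ 2 + rel))"
    by (simp only: algebra_simps power2_eq_square)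
  also have "varZ ^ 2 + rel = varX ^ n * varY - polyX h * varZ"
    by (simp add: rel_def)
  also have "[:c:] + [:a:] * varZ + [:b:] * (varX ^ n * varY - polyX h * varZ)
      = [:c + b * [:0, [:0, 1:] ^ n:], a - b * [:h:]:]"
    unfolding X by (simp add: varZ_def varY_def polyX_def)
  finally show ?case by blast
qed (rule exI[of _ 0], rule exI[of _ 0], rule exI[of _ 0], simp)

text \<open>
  The basis \<open>1, z, y, y z, y\<^sup>2, \<dots>\<close> of \<open>A\<close> over \<open>k[x]\<close>, numbered so that the \<open>k\<close>-th element has
  degree \<open>k\<close> in \<open>z\<close>.
\<close>

definition basis :: "nat \<Rightarrow> 'a fls poly" where
  "basis k = YY ^ (k div 2) * ZZ ^ (k mod 2)"

lemma basis_A [simp]: "basis k \<in> A" by (simp add: basis_def)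

lemma Y_nz [simp]: "YY \<noteq> 0" by (simp add: YY_def)

lemma basis_nz [simp]: "basis k \<noteq> 0" by (simp add: basis_def)

lemma degree_basis [simp]: "Polynomial.degree (basis k) = k"
proof -
  have "Polynomial.degree YY = 2" by (simp add: YY_def)
  then show ?thesis
    unfolding basis_def by (subst degree_mult_eq) (simp_all add: degree_power_eq)
qed

lemma wt_Y: "wt YY = [:of_nat n, 2:]"
  by (simp add: wt_def YY_def fls_inverse_subdegree)

lemma \<iota>_linear:
  fixes a b :: "'a poly poly"
  defines "p \<equiv> \<lambda>k. if even k then coeff a (k div 2) else coeff b (k div 2)"
  assumes "Polynomial.degree a < M" and "Polynomial.degree b < M"
  shows "\<iota> [:a, b:] = (\<Sum>k<2 * M. emb (p k) * basis k)"
proof -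
  have E: "is_hom (peval emb YY)" by (intro is_hom_peval is_hom_emb)
  have "\<iota> [:a, b:] = peval emb YY a + ZZ * peval emb YY b"
    unfolding \<iota>_def by (simp add: peval_pCons[OF E] peval_0)
  also have "\<dots> = (\<Sum>j<M. emb (p (2 * j)) * basis (2 * j) + emb (p (2 * j + 1)) * basis (2 * j + 1))"
    unfolding peval_eq_sum[OF is_hom_emb assms(2)] peval_eq_sum[OF is_hom_emb assms(3)]
    by (simp add: p_def basis_def sum_distrib_left sum.distrib ac_simps mod_Suc
        del: pCons_eq_iff mult_pCons_left mult_pCons_right)
  also have "\<dots> = (\<Sum>k<2 * M. emb (p k) * basis k)"
    by (induction M) (simp_all del: mult_pCons_left mult_pCons_right)
  finally show ?thesis .
qed

lemma A_normal_form:
  assumes "r \<in> A"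
  obtains p N where "r = (\<Sum>k<N. emb (p k) * basis k)"
proof -
  obtain P where P: "r = \<iota> P" using assms by (auto simp: A_def)
  obtain Q a b where Q: "P = rel * Q + [:a, b:]" using reduce_mod_rel by blast
  have "r = \<iota> [:a, b:]" unfolding P Q by (simp add: \<iota>_simps \<iota>_rel)
  also have "\<dots> = (\<Sum>k<2 * Suc (max (Polynomial.degree a) (Polynomial.degree b)).
      emb (if even k then coeff a (k div 2) else coeff b (k div 2)) * basis k)"
    by (rule \<iota>_linear) auto
  finally show thesis by (rule that)
qed

lemma degree_emb_basis: "p \<noteq> 0 \<Longrightarrow> Polynomial.degree (emb p * basis k) = k"
  by (simp add: degree_mult_eq)

lemma degree_emb_basis': "emb p * basis k = 0 \<or> Polynomial.degree (emb p * basis k) = k"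
  using degree_emb_basis[of p k] by (cases "p = 0") (auto simp: emb_simps)

lemma last_nonzero:
  fixes p :: "nat \<Rightarrow> 'c::zero"
  assumes "k < N" and "p k \<noteq> 0"
  obtains K where "K < N" and "p K \<noteq> 0" and "\<And>k. k < N \<Longrightarrow> K < k \<Longrightarrow> p k = 0"
proof -
  have "\<exists>K. (K < N \<and> p K \<noteq> 0) \<and> (\<forall>k. k < N \<and> p k \<noteq> 0 \<longrightarrow> k \<le> K)"
    by (rule ex_has_greatest_nat[of _ k _ N]) (use assms in auto)
  then show thesis using that by (metis not_le)
qed

lemma normal_form_zero:
  assumes "(\<Sum>k<N. emb (p k) * basis k) = 0" and "k < N"
  shows "p k = 0"
proof (rule ccontr)
  assume "p k \<noteq> 0"
  then obtain K where K: "K < N" "p K \<noteq> 0" and out: "\<And>k. k < N \<Longrightarrow> K < k \<Longrightarrow> p k = 0"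
    using assms(2) by (rule_tac last_nonzero[of k N p]) auto
  have "(\<Sum>k<N. emb (p k) * basis k) = (\<Sum>k\<le>K. emb (p k) * basis k)"
    by (rule sum.mono_neutral_right) (use K out in \<open>auto simp: emb_simps\<close>)
  then have z: "(\<Sum>k\<le>K. emb (p k) * basis k) = 0" using assms by simp
  have "Polynomial.degree (\<Sum>k\<le>K. emb (p k) * basis k) = K * 1"
    by (rule degree_sum_top) (use K degree_emb_basis degree_emb_basis' in auto)
  then have K0: "K = 0" using z by simp
  then show False using z K by (simp add: basis_def)
qed

text \<open>
  The kernel of \<open>\<iota>\<close> is the ideal generated by the relation, so \<open>A\<close> is a copy of \<open>R\<close>: a
  remainder \<open>a + b Z\<close> maps to a combination of basis elements of distinct degrees.
\<close>

lemma \<iota>_eq_0: "\<iota> P = 0 \<Longrightarrow> \<exists>Q. P = rel * Q"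
proof -
  assume "\<iota> P = 0"
  obtain Q a b where Q: "P = rel * Q + [:a, b:]" using reduce_mod_rel by blast
  define M where "M = Suc (max (Polynomial.degree a) (Polynomial.degree b))"
  define p where "p = (\<lambda>k. if even k then coeff a (k div 2) else coeff b (k div 2))"
  have "\<iota> [:a, b:] = 0" using \<open>\<iota> P = 0\<close> unfolding Q by (simp add: \<iota>_simps \<iota>_rel)
  then have s: "(\<Sum>k<2 * M. emb (p k) * basis k) = 0"
    using \<iota>_linear[of a M b] by (simp add: M_def p_def)
  have "coeff a j = 0 \<and> coeff b j = 0" for j
  proof (cases "j < M")
    case True
    then show ?thesis
      using normal_form_zero[OF s, of "2 * j"] normal_form_zero[OF s, of "2 * j + 1"]
      by (simp add: p_def)
  qed (auto simp: M_def coeff_eq_0)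
  then have "a = 0" "b = 0" by (simp_all add: poly_eq_iff)
  then show ?thesis using Q by auto
qed

lemma A_normal_form_degree:
  assumes "r \<in> A" and "r \<noteq> 0"
  obtains p where "r = (\<Sum>k\<le>Polynomial.degree r. emb (p k) * basis k)" and "p (Polynomial.degree r) \<noteq> 0"
proof -
  obtain p N where r: "r = (\<Sum>k<N. emb (p k) * basis k)" using A_normal_form[OF assms(1)] .
  have "\<exists>k<N. p k \<noteq> 0"
  proof (rule ccontr)
    assume "\<not> (\<exists>k<N. p k \<noteq> 0)"
    then have "r = 0" unfolding r by (intro sum.neutral) (auto simp: emb_simps)
    then show False using assms(2) by simp
  qed
  then obtain k where k: "k < N" "p k \<noteq> 0" by blast
  obtain K where K: "K < N" "p K \<noteq> 0" and out: "\<And>k. k < N \<Longrightarrow> K < k \<Longrightarrow> p k = 0"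
    by (rule last_nonzero[of k N p]) (use k in auto)
  have r': "r = (\<Sum>k\<le>K. emb (p k) * basis k)"
    unfolding r by (rule sum.mono_neutral_right) (use K out in \<open>auto simp: emb_simps\<close>)
  have "Polynomial.degree r = K * 1"
    unfolding r' by (rule degree_sum_top) (use K degree_emb_basis degree_emb_basis' in auto)
  then show thesis using that r' K by simp
qed

end

section \<open>A vanishing pattern of binomial coefficients\<close>

text \<open>
  If \<open>2 g choose i\<close> vanishes for all \<open>0 < i < 2 g\<close>, then \<open>(1 + T)\<^sup>2\<^sup>g = 1 + T\<^sup>2\<^sup>g\<close>. At
  \<open>T = -1\<close> this reads \<open>0 = 2\<close>, so the characteristic is \<open>2\<close> and square roots are unique, whence
  \<open>(1 + T)\<^sup>g = 1 + T\<^sup>g\<close>. The coefficient of \<open>T\<^sup>g\<close> in \<open>(1 + T)\<^sup>N\<^sup>g = (1 + T\<^sup>g)\<^sup>N\<close> is then \<open>N\<close>, which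
  is nonzero for odd \<open>N\<close>.
\<close>

lemma binomials_not_all_vanish:
  assumes "0 < g" and "odd N"
    and even_vanish: "\<And>i. 0 < i \<Longrightarrow> i < 2 * g \<Longrightarrow> of_nat (2 * g choose i) = (0::'b::idom)"
    and odd_vanish: "of_nat (N * g choose g) = (0::'b)"
  shows False
proof -
  define P M :: "'b poly" where "P = [:1, 1:]" and "M = Polynomial.monom 1 g"
  have cP: "coeff (P ^ k) i = of_nat (k choose i)" for k i
  proof (cases "i \<le> k")
    case True then show ?thesis unfolding P_def by (simp add: coeff_linear_poly_power)
  next
    case False
    have "Polynomial.degree (P ^ k) \<le> k" using degree_power_le[of P k] by (simp add: P_def)
    then show ?thesis using False by (simp add: coeff_eq_0 binomial_eq_0)
  qed
  have M2: "M ^ 2 = Polynomial.monom 1 (2 * g)"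
    by (simp add: M_def monom_power mult.commute)
  have P2g: "P ^ (2 * g) = 1 + M ^ 2"
  proof (rule poly_eqI)
    fix i
    consider "i = 0" | "i = 2 * g" | "0 < i" "i < 2 * g" | "2 * g < i" by linarith
    then show "coeff (P ^ (2 * g)) i = coeff (1 + M ^ 2) i"
      unfolding cP M2 using \<open>0 < g\<close> even_vanish[of i]
      by cases (auto simp: binomial_eq_0)
  qed
  have "0 = poly (P ^ (2 * g)) (-1)" using \<open>0 < g\<close> by (simp add: P_def)
  also have "\<dots> = 1 + (-1) ^ g * (-1) ^ g"
    unfolding P2g by (simp add: M_def poly_monom power2_eq_square)
  also have "\<dots> = 2" by (simp flip: power_mult_distrib)
  finally have two: "(2::'b) = 0" ..
  have two': "(2 :: 'b poly) = 0"
    using two by (metis numeral_poly pCons_0_0)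
  have "P ^ (2 * g) = (P ^ g) ^ 2" by (simp add: power_mult mult.commute)
  moreover have "(B - (1 + M)) ^ 2 = B ^ 2 - (1 + M ^ 2) + 2 * (1 + M + M ^ 2 - B * (1 + M))" for B
    by (simp add: power2_eq_square algebra_simps)
  ultimately have "(P ^ g - (1 + M)) ^ 2
      = P ^ (2 * g) - (1 + M ^ 2) + 2 * (1 + M + M ^ 2 - P ^ g * (1 + M))" by simp
  then have "(P ^ g - (1 + M)) ^ 2 = 0" unfolding P2g two' by simp
  then have Pg: "P ^ g = 1 + M" by simp
  have "\<exists>Q. (1 + M) ^ k = 1 + of_nat k * M + M ^ 2 * Q" for k
  proof (induction k)
    case 0 show ?case by (rule exI[of _ 0]) simp
  next
    case (Suc k)
    then obtain Q where "(1 + M) ^ k = 1 + of_nat k * M + M ^ 2 * Q" by blast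
    then have "(1 + M) ^ Suc k = 1 + of_nat (Suc k) * M + M ^ 2 * (of_nat k + Q + M * Q)"
      by (simp add: algebra_simps power2_eq_square)
    then show ?case by blast
  qed
  then obtain Q where Q: "(1 + M) ^ N = 1 + of_nat N * M + M ^ 2 * Q" by blast
  have "of_nat N * M = Polynomial.monom (of_nat N) g"
    by (simp add: M_def of_nat_poly smult_monom)
  then have "coeff ((1 + M) ^ N) g = of_nat N"
    unfolding Q M2 using \<open>0 < g\<close> by (simp add: coeff_monom_mult)
  moreover have "(1 + M) ^ N = P ^ (N * g)"
    unfolding Pg[symmetric] by (simp add: mult.commute flip: power_mult)
  ultimately have "of_nat N = (0::'b)" using odd_vanish by (simp add: cP)
  moreover obtain j where "N = 2 * j + 1" using \<open>odd N\<close> by (rule oddE)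
  ultimately show False using two by simp
qed

section \<open>Invariants of iterative higher derivations\<close>

context danielewski
begin

lemma A_induct [consumes 1, case_names const X Y Z add mult]:
  assumes r: "r \<in> A" and c: "\<And>c. P (emb [:c:])" and X: "P XX" and Y: "P YY" and Z: "P ZZ"
    and add: "\<And>r s. r \<in> A \<Longrightarrow> s \<in> A \<Longrightarrow> P r \<Longrightarrow> P s \<Longrightarrow> P (r + s)"
    and mult: "\<And>r s. r \<in> A \<Longrightarrow> s \<in> A \<Longrightarrow> P r \<Longrightarrow> P s \<Longrightarrow> P (r * s)"
  shows "P r"
proof -
  have P0: "P 0" using c[of 0] by (simp add: emb_simps)
  have P1: "P 1" using c[of 1] by (simp add: emb_simps flip: one_pCons)
  have pw: "P (s ^ k)" if "s \<in> A" "P s" for s k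
    by (induction k) (use that P1 in \<open>auto intro: mult\<close>)
  have emb: "P (emb p)" for p
  proof (induction p)
    case (pCons a p)
    have "emb (pCons a p) = emb ([:a:] + [:0, 1:] * p)" by simp
    also have "\<dots> = emb [:a:] + XX * emb p" by (simp only: emb_simps emb_X)
    finally show ?case using pCons.IH c X add mult by (metis A_X A_emb A_mult)
  qed (use P0 in \<open>simp add: emb_simps\<close>)
  obtain p N where "r = (\<Sum>k<N. emb (p k) * basis k)" using A_normal_form[OF r] .
  moreover have "P (\<Sum>k<N. emb (p k) * basis k)"
    by (induction N) (auto simp: basis_def intro!: P0 add mult emb pw Y Z simp del: mult_pCons_left mult_pCons_right)
  ultimately show ?thesis by simp
qed

definition mon :: "'a \<Rightarrow> nat \<Rightarrow> nat \<Rightarrow> 'a fls poly" where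
  "mon c a k = emb [:c:] * XX ^ a * basis k"

lemma mon_A [simp]: "mon c a k \<in> A"
  by (simp add: mon_def del: mult_pCons_left mult_pCons_right)

lemma mon_nz: "c \<noteq> 0 \<Longrightarrow> mon c a k \<noteq> 0"
  by (simp add: mon_def del: mult_pCons_left mult_pCons_right)

lemma wt_mon_eq:
  assumes "c \<noteq> 0"
  shows "wt (mon c a k) = of_nat a * wt (XX :: 'a fls poly)
      + (of_nat (k div 2) * wt YY + of_nat (k mod 2) * wt (ZZ :: 'a fls poly))"
  unfolding mon_def basis_def using assms
  by (subst wt.w_mult wt.w_power; simp add: wt_const del: mult_pCons_left mult_pCons_right)+

text \<open>
  The pair \<open>(a, k)\<close> can be read off from the weight; so distinct monomials have distinct weights.
\<close>

lemma wt_mon: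
  assumes "c \<noteq> 0"
  shows "wt (mon c a k) = [:of_nat n * of_nat (k div 2) - of_nat a, of_nat k:]"
proof -
  have k: "rat_of_nat k = 2 * of_nat (k div 2) + of_nat (k mod 2)"
    by (metis mult_div_mod_eq of_nat_add of_nat_mult of_nat_numeral)
  show ?thesis
    unfolding wt_mon_eq[OF assms] k wt_X wt_Y wt_Z by (simp add: of_nat_poly algebra_simps)
qed

lemma A_monomials:
  assumes "r \<in> A" and "r \<noteq> 0"
  obtains S :: "(nat \<times> nat) set" and c where "finite S" and "S \<noteq> {}" and "\<forall>s\<in>S. c s \<noteq> 0"
    and "r = (\<Sum>s\<in>S. mon (c s) (snd s) (fst s))"
proof -
  obtain p N where r: "r = (\<Sum>k<N. emb (p k) * basis k)" using A_normal_form[OF assms(1)] .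
  define T where "T = Sigma {..<N} (\<lambda>k. {..Polynomial.degree (p k)})"
  define c where "c = (\<lambda>s::nat \<times> nat. coeff (p (fst s)) (snd s))"
  define S where "S = {s \<in> T. c s \<noteq> 0}"
  have fin: "finite T" unfolding T_def by simp
  have "emb (p k) * basis k = (\<Sum>a\<le>Polynomial.degree (p k). mon (coeff (p k) a) a k)" for k
  proof -
    have "emb (p k) = emb (\<Sum>a\<le>Polynomial.degree (p k). Polynomial.monom (coeff (p k) a) a)"
      by (simp add: poly_as_sum_of_monoms)
    then show ?thesis
      by (simp only: hom_sum[OF is_hom_emb] emb_monom mon_def sum_distrib_right)
  qed
  then have "r = (\<Sum>s\<in>T. mon (c s) (snd s) (fst s))"
    unfolding r T_def c_def by (simp add: sum.Sigma case_prod_unfold)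
  also have "\<dots> = (\<Sum>s\<in>S. mon (c s) (snd s) (fst s))"
    by (rule sum.mono_neutral_right) (auto simp: fin S_def mon_def emb_simps)
  finally have r': "r = (\<Sum>s\<in>S. mon (c s) (snd s) (fst s))" .
  show thesis
  proof (rule that)
    show "S \<noteq> {}" using r' assms(2) by (metis sum.empty)
  qed (use fin r' in \<open>auto simp: S_def\<close>)
qed

text \<open>
  Distinct monomials have distinct weights, so nothing cancels the heaviest one, which sits at
  index \<open>j\<close>; its weight carries the degree in \<open>z\<close>.
\<close>

lemma A_leading_monomial:
  assumes "r \<in> A" and "r \<noteq> 0"
  obtains S :: "(nat \<times> nat) set" and c j where "finite S" and "j \<in> S" and "\<forall>s\<in>S. c s \<noteq> 0"
    and "r = (\<Sum>s\<in>S. mon (c s) (snd s) (fst s))"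
    and "\<forall>s\<in>S. wt (mon (c s) (snd s) (fst s)) \<le> wt r"
    and "wt r = wt (mon (c j) (snd j) (fst j))" and "fst j = Polynomial.degree r"
    and "wt.below (wt r) (\<Sum>s\<in>S - {j}. mon (c s) (snd s) (fst s))"
proof -
  obtain S :: "(nat \<times> nat) set" and c where S: "finite S" "S \<noteq> {}" "\<forall>s\<in>S. c s \<noteq> 0"
    and r: "r = (\<Sum>s\<in>S. mon (c s) (snd s) (fst s))" by (rule A_monomials[OF assms])
  have nz: "c s \<noteq> 0" if "s \<in> S" for s using S(3) that by blast
  define F where "F = (\<lambda>s. mon (c s) (snd s) (fst s))"
  have rF: "r = sum F S" by (simp add: r F_def)
  show thesis
  proof (rule wt.sum_distinct_degrees[OF S(1,2), of F])
    show "F s \<noteq> 0" if "s \<in> S" for s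
      unfolding F_def by (rule mon_nz[OF nz[OF that]])
    show "inj_on (\<lambda>s. wt (F s)) S"
      unfolding F_def by (rule inj_onI) (auto simp: nz wt_mon prod_eq_iff)
    fix j assume j: "j \<in> S" "wt (sum F S) = wt (F j)" "wt.below (wt (F j)) (sum F (S - {j}))"
      and le: "\<And>s. s \<in> S \<Longrightarrow> wt (F s) \<le> wt (F j)"
    have "fst j = Polynomial.degree r"
      using j(2) unfolding rF[symmetric] by (simp add: F_def wt_mon nz[OF j(1)]) (simp add: wt_def)
    then show thesis
      using that[OF S(1) j(1) S(3) r] j le unfolding rF[symmetric] by (simp add: F_def)
  qed
qed

end

context danielewski
begin

text \<open>
  The slope \<open>\<alpha>\<close> is the maximum of \<open>(wt (D\<^sub>i g) - wt g) / i\<close> over the three generators \<open>g\<close> and the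
  finitely many \<open>i > 0\<close> with \<open>D\<^sub>i g \<noteq> 0\<close>. The bound extends from the generators to monomials by
  the Leibniz rule, and to all of \<open>A\<close> because no monomial outweighs the sum. Some generator attains
  the maximum and so will have positive \<open>tdeg\<close>.
\<close>

lemma exists_slope:
  assumes "iterative_derivation A D"
    and const: "\<And>c i. 0 < i \<Longrightarrow> D i (emb [:c:]) = 0"
    and nontriv: "r0 \<in> A" "0 < i0" "D i0 r0 \<noteq> 0"
  obtains \<alpha> g i where "bounded_derivation wt A D \<alpha>"
    and "g \<in> {XX, YY, ZZ}" and "0 < i" and "D i g \<noteq> 0" and "wt (D i g) = wt g + of_nat i * \<alpha>"
proof -
  interpret iterative_derivation A D by fact
  define T where "T = (SIGMA g:{XX, YY, ZZ :: 'a fls poly}. {i. D i g \<noteq> 0} - {0})"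
  define slope where "slope = (\<lambda>(g, i). [:1 / of_nat i:] * (wt (D i g) - wt (g :: 'a fls poly)) :: rat poly)"
  have inA: "g \<in> A" if "g \<in> {XX, YY, ZZ}" for g using that by auto
  have fin: "finite T" unfolding T_def
    by (intro finite_SigmaI finite_Diff D_finite inA) auto
  \<comment> \<open>A higher derivation that is trivial on the generators is trivial.\<close>
  have "T \<noteq> {}"
  proof
    assume "T = {}"
    then have gen: "D i g = 0" if "0 < i" "g \<in> {XX, YY, ZZ}" for i g
      using that unfolding T_def by blast
    have "\<forall>i>0. D i r0 = 0"
      using nontriv(1)
    proof (induction rule: A_induct)
      case (add r s) then show ?case by (simp add: D_add)
    next
      case (mult r s)
      show ?case
      proof (intro allI impI)
        fix i :: nat assume "0 < i"
        show "D i (r * s) = 0" unfolding D_mult[OF mult(1,2)]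
        proof (rule sum.neutral, rule ballI)
          fix j assume "j \<in> {..i}"
          then show "D j r * D (i - j) s = 0" using mult \<open>0 < i\<close> by (cases "j = 0") auto
        qed
      qed
    qed (use const gen in auto)
    then show False using nontriv by blast
  qed
  then have imne: "slope ` T \<noteq> {}" by simp
  define \<alpha> where "\<alpha> = Max (slope ` T)"
  have slope_eq: "wt (D i g) = wt g + of_nat i * slope (g, i)" if "0 < i" for g i
    using that by (simp add: slope_def of_nat_poly)
  define bnd where "bnd = (\<lambda>\<kappa> r. r \<in> A \<and> (\<forall>i. wt.below_eq (\<kappa> + of_nat i * \<alpha>) (D i r)))"
  have bnd_gen: "bnd (wt g) g" if g: "g \<in> {XX, YY, ZZ}" for g
    unfolding bnd_def
  proof (intro conjI allI inA g)
    fix i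
    show "wt.below_eq (wt g + of_nat i * \<alpha>) (D i g)"
    proof (cases "i = 0 \<or> D i g = 0")
      case True
      then show ?thesis using D_0[OF inA[OF g]] by (auto simp: wt.below_eq_def)
    next
      case False
      then have "(g, i) \<in> T" using g by (auto simp: T_def)
      then have "slope (g, i) \<le> \<alpha>" unfolding \<alpha>_def using fin by (intro Max_ge) auto
      then have "of_nat i * slope (g, i) \<le> of_nat i * \<alpha>" by (intro mult_left_mono) auto
      then show ?thesis using slope_eq[of i g] False by (simp add: wt.below_eq_def)
    qed
  qed
  have bnd_mult: "bnd (\<kappa> + \<kappa>') (r * s)" if "bnd \<kappa> r" "bnd \<kappa>' s" for \<kappa> \<kappa>' r s
    unfolding bnd_def
  proof (intro conjI allI)
    show "r * s \<in> A" using that by (simp add: bnd_def)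
    fix i
    have rs: "r \<in> A" "s \<in> A" using that by (auto simp: bnd_def)
    show "wt.below_eq (\<kappa> + \<kappa>' + of_nat i * \<alpha>) (D i (r * s))"
      unfolding D_mult[OF rs]
    proof (rule wt.below_eq_sum)
      fix j assume "j \<in> {..i}"
      then have "\<kappa> + \<kappa>' + of_nat i * \<alpha> = (\<kappa> + of_nat j * \<alpha>) + (\<kappa>' + of_nat (i - j) * \<alpha>)"
        by (simp add: of_nat_diff algebra_simps)
      then show "wt.below_eq (\<kappa> + \<kappa>' + of_nat i * \<alpha>) (D j r * D (i - j) s)"
        using that by (metis bnd_def wt.below_eq_mult)
    qed
  qed
  have bnd_const: "bnd 0 (emb [:c:])" for c
    unfolding bnd_def
  proof (intro conjI allI)
    fix i
    have "wt.below_eq (of_nat i * \<alpha>) (D i (emb [:c:]))"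
      using const[of i c] D_0[of "emb [:c:]"] wt_const[of c]
      by (cases "i = 0"; cases "c = 0") (auto simp: wt.below_eq_def emb_simps)
    then show "wt.below_eq (0 + of_nat i * \<alpha>) (D i (emb [:c:]))" by simp
  qed simp
  have bnd_power: "bnd (of_nat k * \<kappa>) (r ^ k)" if "bnd \<kappa> r" for k \<kappa> r
  proof (induction k)
    case 0 then show ?case using bnd_const[of 1] by (simp add: emb_simps flip: one_pCons)
  next
    case (Suc k) then show ?case using bnd_mult[OF that Suc] by (simp add: algebra_simps)
  qed
  have bnd_mon: "bnd (wt (mon c a k)) (mon c a k)" if "c \<noteq> 0" for c a k
  proof -
    have "bnd (0 + of_nat a * wt (XX :: 'a fls poly) + (of_nat (k div 2) * wt YY + of_nat (k mod 2) * wt (ZZ :: 'a fls poly)))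
        (mon c a k)"
      unfolding mon_def basis_def by (intro bnd_mult bnd_power bnd_const bnd_gen) auto
    then show ?thesis unfolding wt_mon_eq[OF that] by simp
  qed
  have slope_ok: "wt.below_eq (wt r + of_nat i * \<alpha>) (D i r)" if r: "r \<in> A" for r i
  proof (cases "r = 0")
    case True
    then show ?thesis using D_zero[OF A_0, of i] by simp
  next
    case False
    obtain S :: "(nat \<times> nat) set" and c j where S: "finite S" and "j \<in> S" and c: "\<forall>s\<in>S. c s \<noteq> 0"
      and sum: "r = (\<Sum>s\<in>S. mon (c s) (snd s) (fst s))"
      and le: "\<forall>s\<in>S. wt (mon (c s) (snd s) (fst s)) \<le> wt r"
      and "wt r = wt (mon (c j) (snd j) (fst j))" and "fst j = Polynomial.degree r"
      and "wt.below (wt r) (\<Sum>s\<in>S - {j}. mon (c s) (snd s) (fst s))"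
      by (rule A_leading_monomial[OF r False])
    have D_sum: "D i (\<Sum>s\<in>S'. f s) = (\<Sum>s\<in>S'. D i (f s))" if "finite S'" "\<And>s. f s \<in> A" for f and S' :: "(nat \<times> nat) set"
      using that by (induction S' rule: finite_induct) (auto simp: D_add D_zero)
    have "wt.below_eq (wt r + of_nat i * \<alpha>) (D i (mon (c s) (snd s) (fst s)))" if "s \<in> S" for s
    proof (rule wt.below_eq_mono)
      show "wt.below_eq (wt (mon (c s) (snd s) (fst s)) + of_nat i * \<alpha>) (D i (mon (c s) (snd s) (fst s)))"
        using bnd_mon[of "c s" "snd s" "fst s"] c that unfolding bnd_def by blast
    qed (use le that in simp)
    then have "wt.below_eq (wt r + of_nat i * \<alpha>) (\<Sum>s\<in>S. D i (mon (c s) (snd s) (fst s)))"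
      by (rule wt.below_eq_sum)
    moreover have "D i r = (\<Sum>s\<in>S. D i (mon (c s) (snd s) (fst s)))"
      by (subst sum) (rule D_sum[OF S], simp)
    ultimately show ?thesis by simp
  qed
  have "\<alpha> \<in> slope ` T" unfolding \<alpha>_def by (rule Max_in) (use fin imne in auto)
  then obtain g i where gi: "(g, i) \<in> T" "\<alpha> = slope (g, i)" by auto
  have "bounded_derivation wt A D \<alpha>"
    by unfold_locales (rule slope_ok)
  then show thesis
    by (rule that[of \<alpha> g i]) (use gi slope_eq[of i g] in \<open>auto simp: T_def\<close>)
qed

text \<open>
  This makes \<open>k[x]\<close> the Makar-Limanov invariant of \<open>R\<close>. An annihilated element of positive degree
  forces numerical conditions on the values of \<open>tdeg\<close> at \<open>x\<close>, \<open>y\<close> and \<open>z\<close> that contradict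
  \<open>binomials_not_all_vanish\<close>. For \<open>n = 1\<close> the symmetry between \<open>x\<close> and \<open>y\<close> rules out such a statement; in the
  proof, the values of \<open>tdeg\<close> would then include \<open>g\<close> itself, as the value at \<open>z\<close>.
\<close>

theorem invariants_have_degree_0:
  assumes der: "iterative_derivation A D"
    and const: "\<And>c i. 0 < i \<Longrightarrow> D i (emb [:c:]) = 0"
    and nontriv: "r0 \<in> A" "0 < i0" "D i0 r0 \<noteq> 0"
    and f: "f \<in> A" "\<And>i. 0 < i \<Longrightarrow> D i f = 0"
  shows "Polynomial.degree f = 0"
proof (rule ccontr)
  assume deg: "Polynomial.degree f \<noteq> 0"
  obtain \<alpha> g0 j0 where "bounded_derivation wt A D \<alpha>"
    and g0: "g0 \<in> {XX, YY, ZZ}" "0 < j0" "D j0 g0 \<noteq> 0" "wt (D j0 g0) = wt g0 + of_nat j0 * \<alpha>"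
    by (rule exists_slope[OF der const nontriv])
  then interpret bounded_derivation wt A D \<alpha> by simp
  define m l q where "m = tdeg XX" and "l = tdeg YY" and "q = tdeg ZZ"
  have pos: "0 < m \<or> 0 < l \<or> 0 < q"
    using g0 tdeg_ge[of g0 j0] by (auto simp: m_def l_def q_def)
  have tdeg_const: "tdeg (emb [:c:]) = 0" if "c \<noteq> 0" for c
    by (rule tdeg_eq_0) (use that const in auto)
  have pw: "r ^ k \<noteq> 0 \<and> tdeg (r ^ k) = k * tdeg r" if "r \<in> A" "r \<noteq> 0" for r k
    using tdeg_power[OF that, of k] tdeg_const[of 1] that
    by (cases "k = 0") (auto simp: emb_simps simp flip: one_pCons)
  have tdeg_mon: "tdeg (mon c a k) = a * m + (k div 2) * l + (k mod 2) * q" if "c \<noteq> 0" for c a k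
  proof -
    have "tdeg (mon c a k) = tdeg (emb [:c:]) + tdeg (XX ^ a) + (tdeg (YY ^ (k div 2)) + tdeg (ZZ ^ (k mod 2)))"
      unfolding mon_def basis_def using that
      by (subst tdeg_mult; simp add: pw del: mult_pCons_left mult_pCons_right)+
    then show ?thesis using pw[of XX a] pw[of YY "k div 2"] pw[of ZZ "k mod 2"]
      by (simp add: tdeg_const[OF that] m_def l_def q_def)
  qed
  have tdeg_values: "\<exists>a. tdeg r = a * m + (Polynomial.degree r div 2) * l + (Polynomial.degree r mod 2) * q \<and>
      wt r = [:of_nat n * of_nat (Polynomial.degree r div 2) - of_nat a, of_nat (Polynomial.degree r):]"
    if r: "r \<in> A" "r \<noteq> 0" for r
  proof -
    obtain S :: "(nat \<times> nat) set" and c j where S: "finite S" and j: "j \<in> S" and c: "\<forall>s\<in>S. c s \<noteq> 0"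
      and sum: "r = (\<Sum>s\<in>S. mon (c s) (snd s) (fst s))"
      and "\<forall>s\<in>S. wt (mon (c s) (snd s) (fst s)) \<le> wt r"
      and w: "wt r = wt (mon (c j) (snd j) (fst j))" "fst j = Polynomial.degree r"
        "wt.below (wt r) (\<Sum>s\<in>S - {j}. mon (c s) (snd s) (fst s))"
      by (rule A_leading_monomial[OF r])
    have cj: "c j \<noteq> 0" using c j by blast
    have "r = mon (c j) (snd j) (fst j) + (\<Sum>s\<in>S - {j}. mon (c s) (snd s) (fst s))"
      unfolding sum using S j by (simp add: sum.remove)
    then have "tdeg r = tdeg (mon (c j) (snd j) (fst j))"
      using tdeg_add_below[of "mon (c j) (snd j) (fst j)" "\<Sum>s\<in>S - {j}. mon (c s) (snd s) (fst s)"]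
        w mon_nz[OF cj] by simp
    then show ?thesis using w tdeg_mon[OF cj] wt_mon[OF cj] by (intro exI[of _ "snd j"]) simp
  qed
  \<comment> \<open>In \<open>x\<^sup>n y = z\<^sup>2 + h z\<close> the summand \<open>h z\<close> does not contribute to the leading monomial.\<close>
  have rel_e: "2 * q = n * m + l"
  proof -
    have "tdeg (XX ^ n * YY) = n * m + l"
      using pw[of XX n] by (subst tdeg_mult) (auto simp: m_def l_def simp del: mult_pCons_left mult_pCons_right)
    moreover have "XX ^ n * YY = ZZ * ZZ + emb h * ZZ" unfolding relation by (simp only: algebra_simps)
    moreover have "tdeg (ZZ * ZZ + emb h * ZZ) = tdeg (ZZ * ZZ)"
    proof (rule tdeg_add_below)
      have "wt (emb h * ZZ) \<le> wt (ZZ :: 'a fls poly)"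
        using wt_emb_le[of h] by (subst wt.w_mult) auto
      also have "\<dots> < wt (ZZ * ZZ :: 'a fls poly)"
        by (subst wt.w_mult) (auto simp: wt_Z less_poly_def pos_poly_pCons)
      finally show "wt.below (wt (ZZ * ZZ :: 'a fls poly)) (emb h * ZZ)"
        by (simp add: wt.below_def del: mult_pCons_left mult_pCons_right)
    qed (auto simp del: mult_pCons_left mult_pCons_right)
    moreover have "tdeg (ZZ * ZZ) = 2 * q"
      by (subst tdeg_mult) (auto simp: q_def)
    ultimately show ?thesis by metis
  qed
  have "f \<noteq> 0" using deg by auto
  let ?K = "Polynomial.degree f"
  obtain a where "0 = a * m + (?K div 2) * l + (?K mod 2) * q"
    using tdeg_values[OF f(1) \<open>f \<noteq> 0\<close>] tdeg_eq_0[OF f(1) \<open>f \<noteq> 0\<close> f(2)] by metis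
  then have z: "a * m = 0" "(?K div 2) * l = 0" "(?K mod 2) * q = 0" by auto
  have l0: "l = 0"
  proof (cases "?K mod 2 = 0")
    case True
    then have "?K div 2 \<noteq> 0" using deg by presburger
    then show ?thesis using z(2) by simp
  next
    case False
    then show ?thesis using z(3) rel_e by simp
  qed
  have m0: "0 < m"
  proof (rule ccontr)
    assume "\<not> 0 < m"
    then show False using pos l0 rel_e by simp
  qed
  have nm: "2 * q = n * m" using rel_e l0 by simp
  have mq: "m \<le> q" using nm n2 mult_le_mono1[of 2 n m] by linarith
  have gap: "tdeg r = 0 \<or> m \<le> tdeg r" if r: "r \<in> A" "r \<noteq> 0" for r
  proof -
    obtain a where "tdeg r = a * m + (Polynomial.degree r mod 2) * q" using tdeg_values[OF r] l0 by auto
    then show ?thesis using mq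
      by (cases "a = 0"; cases "Polynomial.degree r mod 2 = 0") (auto intro: trans_le_add1)
  qed
  \<comment> \<open>The top coefficient \<open>D\<^sub>i g\<close>, \<open>i = tdeg g\<close>, has \<open>tdeg\<close> zero, so its leading monomial is
    a power \<open>y\<^sup>s\<close>; the weight of \<open>y\<close> is \<open>(2, n)\<close>.\<close>
  have top: "\<exists>s. wt g + of_nat (tdeg g) * \<alpha> = [:of_nat n * of_nat s, 2 * of_nat s:]" if g: "g \<in> A" "g \<noteq> 0" for g
  proof -
    let ?s = "D (tdeg g - 0) g"
    have s: "?s \<noteq> 0" "wt ?s = wt g + of_nat (tdeg g) * \<alpha>" "tdeg ?s = 0"
      using tdeg_iterate[OF g, of 0] by auto
    have sA: "?s \<in> A" by (rule D_closed[OF g(1)])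
    obtain a where a: "tdeg ?s = a * m + (Polynomial.degree ?s mod 2) * q"
      "wt ?s = [:of_nat n * of_nat (Polynomial.degree ?s div 2) - of_nat a, of_nat (Polynomial.degree ?s):]"
      using tdeg_values[OF sA s(1)] l0 by auto
    have "a = 0" "Polynomial.degree ?s mod 2 = 0" using a(1) s(3) m0 mq by auto
    then have d: "Polynomial.degree ?s = 2 * (Polynomial.degree ?s div 2)"
      using mult_div_mod_eq[of 2 "Polynomial.degree ?s"] by linarith
    have "rat_of_nat (Polynomial.degree ?s) = 2 * of_nat (Polynomial.degree ?s div 2)"
      using arg_cong[OF d, of rat_of_nat] by (simp only: of_nat_mult of_nat_numeral)
    then show ?thesis using a(2) s(2) \<open>a = 0\<close> by (intro exI[of _ "Polynomial.degree ?s div 2"]) simp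
  qed
  have X_nz: "XX \<noteq> 0" and Z_nz: "ZZ \<noteq> 0" by simp_all
  obtain s where s: "wt XX + of_nat m * \<alpha> = [:of_nat n * of_nat s, 2 * of_nat s:]"
    using top[OF A_X X_nz] unfolding m_def by (rule exE)
  obtain s' where s': "wt ZZ + of_nat q * \<alpha> = [:of_nat n * of_nat s', 2 * of_nat s':]"
    using top[OF A_Z Z_nz] unfolding q_def by (rule exE)
  \<comment> \<open>Eliminating \<open>\<alpha>\<close> from the two weight equations leaves a parity condition.\<close>
  have "2 * (of_nat q * \<alpha>) = of_nat n * (of_nat m * \<alpha>)"
    using arg_cong[OF nm, of "\<lambda>k. of_nat k * \<alpha>"] by (simp add: algebra_simps)
  then have "2 * ([:of_nat n * of_nat s', 2 * of_nat s':] - wt (ZZ :: 'a fls poly))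
      = of_nat n * ([:of_nat n * of_nat s, 2 * of_nat s:] - wt (XX :: 'a fls poly))"
    using s s' by (metis add_diff_cancel_left')
  then have "rat_of_nat (2 * s') = of_nat (n * s + 1)"
    unfolding wt_X wt_Z by (simp add: of_nat_poly numeral_poly algebra_simps)
  then have par: "2 * s' = n * s + 1" by (simp only: of_nat_eq_iff)
  then have "odd n" by (metis even_add even_mult_iff odd_one dvd_triv_left)
  then have "even m" using nm by (metis dvd_triv_left even_mult_iff)
  then obtain g where g: "m = 2 * g" by (rule evenE)
  then have "0 < g" and qg: "q = n * g" using m0 nm by auto
  show False
  proof (rule binomials_not_all_vanish[OF \<open>0 < g\<close> \<open>odd n\<close>, where 'b = "'a fls poly"])
    fix i assume i: "0 < i" "i < 2 * g"
    show "of_nat (2 * g choose i) = (0 :: 'a fls poly)"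
    proof (rule ccontr)
      assume nz: "of_nat (2 * g choose i) \<noteq> (0 :: 'a fls poly)"
      then show False
        using tdeg_iterate[of XX i] gap[OF D_closed[of XX "m - i"]] i g by (auto simp: m_def)
    qed
  next
    show "of_nat (n * g choose g) = (0 :: 'a fls poly)"
    proof (rule ccontr)
      assume "of_nat (n * g choose g) \<noteq> (0 :: 'a fls poly)"
      then show False
        using tdeg_iterate[of ZZ g] gap[OF D_closed[of ZZ "q - g"]] \<open>0 < g\<close> g qg n2 by (auto simp: q_def)
    qed
  qed
qed

end

section \<open>The higher derivation of the translations\<close>

context danielewski
begin

text \<open>
  The image of \<open>p(z)\<close> is \<open>p(z + x\<^sup>n t)\<close>, a polynomial in the new outer variable \<open>t\<close>.
\<close>

definition Taylor :: "'a fls poly \<Rightarrow> 'a fls poly poly" where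
  "Taylor = peval (\<lambda>c. [:[:c:]:]) [:ZZ, XX ^ n:]"

definition \<Delta> :: "nat \<Rightarrow> 'a fls poly \<Rightarrow> 'a fls poly" where
  "\<Delta> i p = coeff (Taylor p) i"

lemma is_hom_const2: "is_hom (\<lambda>c. [:[:c:]:])"
  by (rule is_hom_comp[OF is_hom_const_poly is_hom_const_poly])

lemma is_hom_Taylor: "is_hom Taylor"
  unfolding Taylor_def by (intro is_hom_peval is_hom_const2)

lemma Taylor_pCons: "Taylor (pCons c p) = [:[:c:]:] + [:ZZ, XX ^ n:] * Taylor p"
  unfolding Taylor_def by (rule peval_pCons[OF is_hom_const2])

lemma Taylor_0: "Taylor 0 = 0"
  by (simp add: Taylor_def peval_0)

lemma XX_power: "XX ^ k = [:fls_X ^ k:]"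
  by (simp add: poly_const_pow)

text \<open>
  Up to the power of \<open>x\<close>, the operator \<open>\<Delta> i\<close> is the \<open>i\<close>-th Hasse derivative in \<open>z\<close>.
\<close>

lemma coeff_Delta: "coeff (\<Delta> i p) j = of_nat (i + j choose i) * (fls_X ^ n) ^ i * coeff p (i + j)"
proof (induction p arbitrary: i j)
  case 0
  show ?case by (simp add: \<Delta>_def Taylor_0)
next
  case (pCons c p)
  have "\<Delta> i (pCons c p) = coeff ([:[:c:]:]) i + ZZ * \<Delta> i p + (case i of 0 \<Rightarrow> 0 | Suc i' \<Rightarrow> XX ^ n * \<Delta> i' p)"
    by (simp add: \<Delta>_def Taylor_pCons coeff_pCons split: nat.split)
  then have "coeff (\<Delta> i (pCons c p)) j = coeff (coeff [:[:c:]:] i) j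
      + (case j of 0 \<Rightarrow> 0 | Suc j' \<Rightarrow> coeff (\<Delta> i p) j')
      + (case i of 0 \<Rightarrow> 0 | Suc i' \<Rightarrow> fls_X ^ n * coeff (\<Delta> i' p) j)"
    by (simp add: XX_power coeff_pCons split: nat.split)
  then show ?case
    unfolding pCons.IH by (cases i; cases j) (simp_all add: algebra_simps)
qed

lemma Delta_const: "0 < i \<Longrightarrow> \<Delta> i [:c:] = 0"
  by (rule poly_eqI) (simp add: coeff_Delta coeff_pCons split: nat.split)

lemma Delta_0: "\<Delta> 0 p = p"
  by (rule poly_eqI) (simp add: coeff_Delta)

lemma Taylor_Z: "Taylor ZZ = [:ZZ, XX ^ n:]"
  unfolding Taylor_def by (rule peval_X[OF is_hom_const2])

lemma Taylor_Y: "Taylor YY = [:YY, 2 * ZZ + emb h, XX ^ n:]"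
proof -
  have "inverse (fls_X ^ n) * fls_X ^ n = (1 :: 'a fls)" by simp
  then show ?thesis
    unfolding YY_def
    by (simp add: Taylor_pCons Taylor_0 XX_power emb_def algebra_simps) (rule numeral_poly[symmetric])
qed

lemma Delta_closed: "r \<in> A \<Longrightarrow> \<Delta> i r \<in> A"
proof (induction arbitrary: i rule: A_induct)
  case (const c)
  show ?case
  proof (cases "i = 0")
    case False
    then show ?thesis by (simp add: emb_const Delta_const)
  qed (simp add: Delta_0)
next
  case X
  then show ?case using Delta_const[of i "fls_X"] Delta_0[of XX] by (cases "i = 0") auto
next
  case Y
  have "2 * ZZ + emb h = ZZ + ZZ + emb h" by (simp only: mult_2)
  then have "2 * ZZ + emb h \<in> A" by (metis A_Z A_add A_emb)
  then show ?case by (simp add: \<Delta>_def Taylor_Y coeff_pCons split: nat.split del: A_add)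
next
  case Z
  show ?case using A_power[OF A_X, of n] by (simp add: \<Delta>_def Taylor_Z coeff_pCons split: nat.split)
next
  case (add r s)
  then show ?case by (simp add: \<Delta>_def hom_add[OF is_hom_Taylor])
next
  case (mult r s)
  then show ?case by (simp add: \<Delta>_def hom_mult[OF is_hom_Taylor] coeff_mult)
qed

lemma Delta_iterate: "\<Delta> i (\<Delta> j p) = of_nat (i + j choose i) * \<Delta> (i + j) p"
proof (rule poly_eqI)
  fix k
  have "(i + j + k choose (i + j)) * (i + j choose j) = (i + j + k choose j) * (i + k choose i)"
    using choose_mult[of j "i + j" "i + j + k"] by simp
  moreover have "i + j choose j = i + j choose i" using binomial_symmetric[of j "i + j"] by simp
  ultimately have "(i + j choose i) * (i + j + k choose (i + j)) = (i + k choose i) * (j + (i + k) choose j)"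
    by (simp add: ac_simps)
  then have bin: "(of_nat (i + j choose i) * of_nat (i + j + k choose (i + j)) :: 'a fls)
      = of_nat (i + k choose i) * of_nat (j + (i + k) choose j)"
    by (metis of_nat_mult)
  have const: "coeff (of_nat N * q) k = of_nat N * coeff q k" for N and q :: "'a fls poly"
    by (simp add: of_nat_poly)
  let ?X = "fls_X ^ n :: 'a fls"
  have "coeff (\<Delta> i (\<Delta> j p)) k = (of_nat (i + k choose i) * of_nat (j + (i + k) choose j))
      * (?X ^ i * ?X ^ j * coeff p (i + j + k))"
    unfolding coeff_Delta by (simp only: ac_simps)
  also have "\<dots> = coeff (of_nat (i + j choose i) * \<Delta> (i + j) p) k"
    unfolding bin[symmetric] const coeff_Delta power_add by (simp only: ac_simps)
  finally show "coeff (\<Delta> i (\<Delta> j p)) k = coeff (of_nat (i + j choose i) * \<Delta> (i + j) p) k" .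
qed

lemma iterative_derivation_Delta: "iterative_derivation A \<Delta>"
proof
  fix r
  show "finite {i. \<Delta> i r \<noteq> 0}"
    using MOST_coeff_eq_0[of "Taylor r"] by (simp add: \<Delta>_def eventually_cofinite)
qed (simp_all add: Delta_closed Delta_0 Delta_iterate, simp_all add: \<Delta>_def hom_simps[OF is_hom_Taylor] coeff_mult)

section \<open>The shape of an automorphism\<close>

text \<open>
  Maps are total on \<open>k((x))[z]\<close>, but only their values on \<open>A\<close> matter.
\<close>

definition endo :: "('a fls poly \<Rightarrow> 'a fls poly) \<Rightarrow> bool" where
  "endo \<phi> \<longleftrightarrow> (\<forall>r\<in>A. \<phi> r \<in> A) \<and> (\<forall>r\<in>A. \<forall>s\<in>A. \<phi> (r + s) = \<phi> r + \<phi> s \<and> \<phi> (r * s) = \<phi> r * \<phi> s)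
    \<and> (\<forall>c. \<phi> (emb [:c:]) = emb [:c:])"

lemma
  assumes "endo \<phi>"
  shows endo_closed: "r \<in> A \<Longrightarrow> \<phi> r \<in> A"
    and endo_add: "r \<in> A \<Longrightarrow> s \<in> A \<Longrightarrow> \<phi> (r + s) = \<phi> r + \<phi> s"
    and endo_mult: "r \<in> A \<Longrightarrow> s \<in> A \<Longrightarrow> \<phi> (r * s) = \<phi> r * \<phi> s"
    and endo_const: "\<phi> (emb [:c:]) = emb [:c:]"
    and endo_0: "\<phi> 0 = 0" and endo_1: "\<phi> 1 = 1"
    and endo_power: "r \<in> A \<Longrightarrow> \<phi> (r ^ k) = \<phi> r ^ k"
    and endo_of_nat: "r \<in> A \<Longrightarrow> \<phi> (of_nat N * r) = of_nat N * \<phi> r"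
    and endo_sum: "(\<And>i. i \<in> I \<Longrightarrow> f i \<in> A) \<Longrightarrow> \<phi> (sum f I) = (\<Sum>i\<in>I. \<phi> (f i))"
proof -
  show add: "\<phi> (r + s) = \<phi> r + \<phi> s" and mult: "\<phi> (r * s) = \<phi> r * \<phi> s"
    if "r \<in> A" "s \<in> A" for r s
    using assms that by (auto simp: endo_def)
  show "\<phi> r \<in> A" if "r \<in> A" for r using assms that by (auto simp: endo_def)
  show c: "\<phi> (emb [:c:]) = emb [:c:]" for c using assms by (auto simp: endo_def)
  show 0: "\<phi> 0 = 0" using c[of 0] by (simp add: emb_simps)
  show 1: "\<phi> 1 = 1" using c[of 1] by (simp add: emb_simps flip: one_pCons)
  show "\<phi> (r ^ k) = \<phi> r ^ k" if "r \<in> A" for r k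
    by (induction k) (use that in \<open>simp_all add: 1 mult\<close>)
  have N: "(of_nat N :: 'a fls poly) = emb [:of_nat N:]"
    using emb_simps(8)[of N, where 'a = 'a] by (simp add: of_nat_poly)
  show "\<phi> (of_nat N * r) = of_nat N * \<phi> r" if "r \<in> A"
    unfolding N using that by (simp add: mult c)
  show "\<phi> (sum f I) = (\<Sum>i\<in>I. \<phi> (f i))" if "\<And>i. i \<in> I \<Longrightarrow> f i \<in> A"
    using that by (induction I rule: infinite_finite_induct) (auto simp: 0 add)
qed

lemma endo_emb:
  assumes "endo \<phi>" and X: "\<phi> XX = emb p"
  shows "\<phi> (emb q) = emb (pcompose q p)"
proof (induction q)
  case (pCons c q)
  have "emb (pCons c q) = emb ([:c:] + [:0, 1:] * q)" by simp
  also have "\<dots> = emb [:c:] + XX * emb q" by (simp only: emb_simps emb_X)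
  finally have "\<phi> (emb (pCons c q)) = emb [:c:] + emb p * emb (pcompose q p)"
    using pCons.IH X by (simp add: endo_add[OF assms(1)] endo_mult[OF assms(1)] endo_const[OF assms(1)]
      del: mult_pCons_left mult_pCons_right)
  then show ?case by (simp add: pcompose_pCons emb_simps)
qed (simp add: emb_simps endo_0[OF assms(1)])

lemma endo_uminus: "endo \<phi> \<Longrightarrow> r \<in> A \<Longrightarrow> \<phi> (- r) = - \<phi> r"
  using endo_add[of \<phi> r "- r"] endo_0[of \<phi>] by (simp add: eq_neg_iff_add_eq_0 add.commute)

lemma endo_diff: "endo \<phi> \<Longrightarrow> r \<in> A \<Longrightarrow> s \<in> A \<Longrightarrow> \<phi> (r - s) = \<phi> r - \<phi> s"
  using endo_add[of \<phi> r "- s"] endo_uminus[of \<phi> s] by simp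

definition inverse_pair where
  "inverse_pair \<phi> \<psi> \<longleftrightarrow> endo \<phi> \<and> endo \<psi> \<and> (\<forall>r\<in>A. \<phi> (\<psi> r) = r \<and> \<psi> (\<phi> r) = r)"

lemma inverse_pair_sym: "inverse_pair \<phi> \<psi> \<Longrightarrow> inverse_pair \<psi> \<phi>"
  by (auto simp: inverse_pair_def)

lemma A_degree_0:
  assumes "r \<in> A" and "Polynomial.degree r = 0"
  obtains p where "r = emb p"
proof (cases "r = 0")
  case True
  then show thesis using that[of 0] by (simp add: emb_simps)
next
  case False
  obtain p where "r = (\<Sum>k\<le>0. emb (p k) * basis k)"
    using A_normal_form_degree[OF assms(1) False] assms(2) by metis
  then show thesis using that[of "p 0"] by (simp add: basis_def)
qed

text \<open>
  The conjugate \<open>\<phi> \<circ> \<Delta>\<^sub>i \<circ> \<psi>\<close> annihilates \<open>\<phi>(x)\<close> and is nontrivial, since it maps \<open>\<phi>(z)\<close> to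
  \<open>\<phi>(x\<^sup>n)\<close> for \<open>i = 1\<close>.
\<close>

lemma automorphism_X:
  assumes pair: "inverse_pair \<phi> \<psi>"
  obtains p where "\<phi> XX = emb p"
proof -
  from pair have \<phi>: "endo \<phi>" and \<psi>: "endo \<psi>" and inv: "\<And>r. r \<in> A \<Longrightarrow> \<phi> (\<psi> r) = r"
    "\<And>r. r \<in> A \<Longrightarrow> \<psi> (\<phi> r) = r" by (auto simp: inverse_pair_def)
  interpret Delta: iterative_derivation A \<Delta> by (rule iterative_derivation_Delta)
  define D where "D i r = \<phi> (\<Delta> i (\<psi> r))" for i r
  note cl = endo_closed[OF \<phi>] endo_closed[OF \<psi>] Delta_closed
  have "iterative_derivation A D"
  proof
    fix r s i j assume r: "r \<in> A"
    show "D i r \<in> A" "D 0 r = r" using r by (simp_all add: D_def cl Delta_0 inv)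
    show "D i (D j r) = of_nat (i + j choose i) * D (i + j) r"
      using r by (simp add: D_def cl inv Delta_iterate endo_of_nat[OF \<phi>])
    have "{i. D i r \<noteq> 0} \<subseteq> {i. \<Delta> i (\<psi> r) \<noteq> 0}" by (auto simp: D_def endo_0[OF \<phi>])
    then show "finite {i. D i r \<noteq> 0}" by (rule finite_subset) (rule Delta.D_finite, rule cl, rule r)
    assume s: "s \<in> A"
    show "D i (r + s) = D i r + D i s"
      using r s by (simp add: D_def cl Delta.D_add endo_add[OF \<phi>] endo_add[OF \<psi>])
    show "D i (r * s) = (\<Sum>k\<le>i. D k r * D (i - k) s)"
      using r s by (simp add: D_def cl Delta.D_mult endo_sum[OF \<phi>] endo_mult[OF \<phi>] endo_mult[OF \<psi>])
  qed auto
  moreover have "D i (emb [:c:]) = 0" if "0 < i" for i c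
    unfolding D_def endo_const[OF \<psi>] using that by (simp add: emb_const Delta_const endo_0[OF \<phi>])
  moreover have "D 1 (\<phi> ZZ) \<noteq> 0"
  proof
    assume "D 1 (\<phi> ZZ) = 0"
    then have "\<phi> (XX ^ n) = 0" by (simp add: D_def inv) (simp add: \<Delta>_def Taylor_Z)
    then have "\<psi> (\<phi> (XX ^ n)) = 0" by (simp add: endo_0[OF \<psi>])
    then show False by (simp add: inv)
  qed
  moreover have "D i (\<phi> XX) = 0" if "0 < i" for i
    using that by (simp add: D_def inv Delta_const endo_0[OF \<phi>])
  ultimately have "Polynomial.degree (\<phi> XX) = 0"
    using invariants_have_degree_0[of D "\<phi> ZZ" 1 "\<phi> XX"] by (simp add: cl)
  then show thesis using A_degree_0[of "\<phi> XX"] that by (auto simp: cl)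
qed

text \<open>
  Both \<open>\<phi>(x) = p(x)\<close> and \<open>\<psi>(x) = q(x)\<close> are polynomials, and \<open>p(q(x)) = x\<close> forces degree \<open>1\<close>.
\<close>

lemma automorphism_X_affine:
  assumes pair: "inverse_pair \<phi> \<psi>"
  obtains \<nu> \<mu> where "\<mu> \<noteq> 0" and "\<phi> XX = emb [:\<nu>, \<mu>:]"
proof -
  obtain p q where p: "\<phi> XX = emb p" and q: "\<psi> XX = emb q"
    using automorphism_X[OF pair] automorphism_X[OF inverse_pair_sym[OF pair]] by metis
  have "emb [:0, 1:] = \<psi> (emb p)" using pair p by (auto simp: inverse_pair_def emb_X simp flip: p)
  also have "\<dots> = emb (pcompose p q)" using pair q by (intro endo_emb) (auto simp: inverse_pair_def)
  finally have "pcompose p q = [:0, 1:]" by simp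
  then have "Polynomial.degree p * Polynomial.degree q = 1" by (simp flip: degree_pcompose)
  then have "Polynomial.degree p = 1" by simp
  then obtain \<mu> \<nu> where "p = [:\<nu>, \<mu>:]" "\<mu> \<noteq> 0" by (rule degree1_coeffs)
  then show thesis using that p by blast
qed

end

lemma X_power_dvd_mult_cancel:
  fixes u v :: "'a::field poly"
  assumes "[:0, 1:] ^ k dvd u * v" and "poly v 0 \<noteq> 0"
  shows "[:0, 1:] ^ k dvd u"
proof (cases "u = 0")
  case False
  have v: "v \<noteq> 0" "Polynomial.order 0 v = 0" using assms(2) by (auto simp: order_root)
  have "k \<le> Polynomial.order 0 (u * v)"
    using assms(1) order_divides[of 0 k "u * v"] False v by simp
  then have "k \<le> Polynomial.order 0 u" using False v by (subst (asm) order_mult) auto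
  then show ?thesis using order_divides[of 0 k u] by simp
qed simp

lemma X_power_dvd_imp_zero:
  fixes u :: "'a::field poly"
  assumes "[:0, 1:] ^ k dvd u" and "Polynomial.degree u < k"
  shows "u = 0"
proof (rule ccontr)
  assume "u \<noteq> 0"
  then have "Polynomial.degree ([:0, 1:] ^ k :: 'a poly) \<le> Polynomial.degree u"
    by (intro dvd_imp_degree_le assms(1))
  then show False using assms(2) by (simp add: degree_power_eq)
qed

lemma smult_left_cancel:
  fixes p q :: "'a::field poly"
  assumes "c \<noteq> 0" and "smult c p = smult c q"
  shows "p = q"
  using assms by (simp add: poly_eq_iff)

context danielewski
begin

text \<open>
  Coefficients in \<open>k[x]\<close> keep degree \<open>0\<close> and the relation gives \<open>\<phi>(y)\<close> twice the degree of
  \<open>\<phi>(z)\<close>; so the images of the basis elements have distinct degrees, provided that \<open>\<phi>(z)\<close> is not in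
  \<open>k[x]\<close>.
\<close>

lemma degree_automorphism:
  assumes \<phi>: "endo \<phi>" and X: "\<phi> XX = emb p" and p: "0 < Polynomial.degree p"
    and Z: "1 \<le> Polynomial.degree (\<phi> ZZ)" and r: "r \<in> A" "r \<noteq> 0"
  shows "Polynomial.degree (\<phi> r) = Polynomial.degree r * Polynomial.degree (\<phi> ZZ)"
proof -
  let ?B = "Polynomial.degree (\<phi> ZZ)"
  note e = endo_add[OF \<phi>] endo_mult[OF \<phi>] endo_power[OF \<phi>] endo_emb[OF \<phi> X]
  have p0: "p \<noteq> 0" using p by auto
  have Znz: "\<phi> ZZ \<noteq> 0" using Z by auto
  have "\<phi> (XX ^ n * YY) = \<phi> (ZZ * (ZZ + emb h))" unfolding relation ..
  then have rel: "emb p ^ n * \<phi> YY = \<phi> ZZ * (\<phi> ZZ + emb (pcompose h p))"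
    by (simp add: e X del: mult_pCons_left mult_pCons_right)
  have deg: "Polynomial.degree (\<phi> ZZ + emb (pcompose h p)) = ?B"
    using Z by (intro degree_add_eq_left) simp
  then have nz: "\<phi> ZZ + emb (pcompose h p) \<noteq> 0" using Z by auto
  have Ynz: "\<phi> YY \<noteq> 0" using rel nz Znz by auto
  have "Polynomial.degree (emb p ^ n * \<phi> YY) = ?B + ?B"
    unfolding rel using nz Znz deg by (simp add: degree_mult_eq)
  then have Y: "Polynomial.degree (\<phi> YY) = 2 * ?B"
    using p0 Ynz by (simp add: degree_mult_eq degree_power_eq)
  have U: "\<phi> (basis k) \<noteq> 0 \<and> Polynomial.degree (\<phi> (basis k)) = k * ?B" for k
  proof -
    have "k * ?B = (k div 2 * 2 + k mod 2) * ?B" by simp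
    also have "\<dots> = k div 2 * (2 * ?B) + k mod 2 * ?B" by (simp only: add_mult_distrib mult.assoc)
    finally show ?thesis
      using Znz Ynz Y by (simp add: basis_def e degree_mult_eq degree_power_eq)
  qed
  have comp_nz: "pcompose q p \<noteq> 0" if "q \<noteq> 0" for q
    using pcompose_eq_0[of q p] p that by blast
  obtain c where c: "r = (\<Sum>k\<le>Polynomial.degree r. emb (c k) * basis k)" "c (Polynomial.degree r) \<noteq> 0"
    by (rule A_normal_form_degree[OF r])
  have "\<phi> r = (\<Sum>k\<le>Polynomial.degree r. emb (pcompose (c k) p) * \<phi> (basis k))"
    by (subst c(1), subst endo_sum[OF \<phi>]) (simp_all add: e)
  moreover have "Polynomial.degree (\<Sum>k\<le>Polynomial.degree r. emb (pcompose (c k) p) * \<phi> (basis k))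
      = Polynomial.degree r * ?B"
  proof (rule degree_sum_top)
    show "emb (pcompose (c (Polynomial.degree r)) p) * \<phi> (basis (Polynomial.degree r)) \<noteq> 0"
      using comp_nz[OF c(2)] U by simp
    have "emb (pcompose (c k) p) * \<phi> (basis k) = 0
        \<or> Polynomial.degree (emb (pcompose (c k) p) * \<phi> (basis k)) = k * ?B" for k
      using U[of k] by (cases "pcompose (c k) p = 0") (auto simp: emb_simps degree_mult_eq)
    then show "emb (pcompose (c k) p) * \<phi> (basis k) = 0
        \<or> Polynomial.degree (emb (pcompose (c k) p) * \<phi> (basis k)) = k * ?B" for k .
    show "Polynomial.degree (emb (pcompose (c (Polynomial.degree r)) p) * \<phi> (basis (Polynomial.degree r)))
      = Polynomial.degree r * ?B"
      using comp_nz[OF c(2)] U by (simp add: degree_mult_eq)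
  qed (rule Z)
  ultimately show ?thesis by simp
qed

text \<open>
  The degree of \<open>\<phi>(z)\<close> divides the degree \<open>1\<close> of \<open>z = \<phi>(\<psi>(z))\<close>. It is not \<open>0\<close>, since otherwise
  all of \<open>A\<close> would be mapped into degree \<open>0\<close>.
\<close>

lemma automorphism_degree_Z:
  assumes pair: "inverse_pair \<phi> \<psi>"
  shows "Polynomial.degree (\<phi> ZZ) = 1"
proof -
  from pair have \<phi>: "endo \<phi>" and \<psi>: "endo \<psi>" and inv: "\<phi> (\<psi> ZZ) = ZZ"
    by (auto simp: inverse_pair_def)
  obtain \<nu> \<mu> where \<mu>: "\<mu> \<noteq> 0" and pX: "\<phi> XX = emb [:\<nu>, \<mu>:]" by (rule automorphism_X_affine[OF pair])
  note e = endo_add[OF \<phi>] endo_mult[OF \<phi>] endo_power[OF \<phi>] endo_emb[OF \<phi> pX]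
  have Z1: "1 \<le> Polynomial.degree (\<phi> ZZ)"
  proof (rule ccontr)
    assume "\<not> 1 \<le> Polynomial.degree (\<phi> ZZ)"
    then have Z: "Polynomial.degree (\<phi> ZZ) = 0" by simp
    have "Polynomial.degree (\<phi> r) = 0" if "r \<in> A" for r
      using that
    proof (induction rule: A_induct)
      case (const c) then show ?case by (simp add: endo_const[OF \<phi>])
    next
      case X then show ?case by (simp add: pX)
    next
      case Y
      have "\<phi> (XX ^ n * YY) = \<phi> (ZZ * (ZZ + emb h))" unfolding relation ..
      then have rel: "emb [:\<nu>, \<mu>:] ^ n * \<phi> YY = \<phi> ZZ * (\<phi> ZZ + emb (pcompose h [:\<nu>, \<mu>:]))"
        by (simp add: e pX del: mult_pCons_left mult_pCons_right)
      have "Polynomial.degree (\<phi> ZZ * (\<phi> ZZ + emb (pcompose h [:\<nu>, \<mu>:]))) \<le> 0 + 0"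
        using Z by (intro order_trans[OF degree_mult_le] add_mono degree_add_le) auto
      then have "Polynomial.degree (emb [:\<nu>, \<mu>:] ^ n * \<phi> YY) = 0" unfolding rel by simp
      moreover have "emb [:\<nu>, \<mu>:] ^ n \<noteq> 0" using \<mu> by simp
      ultimately show ?case by (cases "\<phi> YY = 0") (simp_all add: degree_mult_eq)
    next
      case (add r s)
      then have "Polynomial.degree (\<phi> r + \<phi> s) \<le> 0" by (intro degree_add_le) auto
      then show ?case using add by (simp add: e)
    next
      case (mult r s)
      then have "Polynomial.degree (\<phi> r * \<phi> s) \<le> 0 + 0" by (intro order_trans[OF degree_mult_le]) auto
      then show ?case using mult by (simp add: e)
    qed (rule Z)
    from this[OF endo_closed[OF \<psi> A_Z]] show False unfolding inv by simp
  qed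
  have "\<psi> ZZ \<noteq> 0"
  proof
    assume "\<psi> ZZ = 0"
    then have "ZZ = 0" using inv endo_0[OF \<phi>] by metis
    then show False by simp
  qed
  then have "Polynomial.degree (\<phi> (\<psi> ZZ)) = Polynomial.degree (\<psi> ZZ) * Polynomial.degree (\<phi> ZZ)"
    by (intro degree_automorphism[OF \<phi> pX _ Z1]) (use \<mu> endo_closed[OF \<psi> A_Z] in auto)
  then show ?thesis unfolding inv by simp
qed

lemma emb_independent:
  assumes "emb a + emb b * ZZ + emb c * ZZ ^ 2 = emb a' + emb b' * ZZ + emb c' * ZZ ^ 2"
  shows "a = a'" and "b = b'" and "c = c'"
  using assms by (auto simp: emb_def fps_of_poly_eq_iff power2_eq_square)

text \<open>
  The coefficient of \<open>z\<close> in \<open>\<phi>(z)\<close> is a unit of \<open>k[x]\<close>: compare the coefficients of \<open>z\<close> in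
  \<open>z = \<phi>(\<psi>(z))\<close>.
\<close>

lemma automorphism_Z_affine:
  assumes pair: "inverse_pair \<phi> \<psi>"
  obtains a \<kappa> where "\<kappa> \<noteq> 0" and "\<phi> ZZ = emb a + emb [:\<kappa>:] * ZZ"
proof -
  from pair have \<phi>: "endo \<phi>" and \<psi>: "endo \<psi>" and inv: "\<phi> (\<psi> ZZ) = ZZ"
    by (auto simp: inverse_pair_def)
  have form: "\<exists>a b. \<phi>' ZZ = emb a + emb b * ZZ" if "inverse_pair \<phi>' \<psi>'" for \<phi>' \<psi>'
  proof -
    have deg: "Polynomial.degree (\<phi>' ZZ) = 1" by (rule automorphism_degree_Z[OF that])
    have "\<phi>' ZZ \<in> A" using that endo_closed[of \<phi>' ZZ] by (auto simp: inverse_pair_def)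
    moreover have "\<phi>' ZZ \<noteq> 0" using deg by auto
    ultimately obtain c where "\<phi>' ZZ = (\<Sum>k\<le>Polynomial.degree (\<phi>' ZZ). emb (c k) * basis k)"
      by (rule A_normal_form_degree)
    then have "\<phi>' ZZ = emb (c 0) + emb (c 1) * ZZ"
      unfolding deg by (simp add: basis_def del: mult_pCons_left mult_pCons_right)
    then show ?thesis by blast
  qed
  obtain p where X: "\<phi> XX = emb p" by (rule automorphism_X[OF pair])
  obtain a b where ab: "\<phi> ZZ = emb a + emb b * ZZ" using form[OF pair] by blast
  obtain a' b' where ab': "\<psi> ZZ = emb a' + emb b' * ZZ" using form[OF inverse_pair_sym[OF pair]] by blast
  have "ZZ = emb (pcompose a' p) + emb (pcompose b' p) * (emb a + emb b * ZZ)"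
    using inv unfolding ab' by (simp add: endo_add[OF \<phi>] endo_mult[OF \<phi>] endo_emb[OF \<phi> X] ab
      del: mult_pCons_left mult_pCons_right)
  then have "emb 0 + emb 1 * ZZ + emb 0 * ZZ ^ 2
      = emb (pcompose a' p + pcompose b' p * a) + emb (pcompose b' p * b) * ZZ + emb 0 * ZZ ^ 2"
    by (simp add: emb_simps algebra_simps del: mult_pCons_left mult_pCons_right)
  then have "1 = pcompose b' p * b" by (rule emb_independent)
  then have "b dvd 1" by (metis dvd_triv_right)
  moreover have "b \<noteq> 0" using \<open>1 = pcompose b' p * b\<close> by auto
  ultimately obtain \<kappa> where "b = [:\<kappa>:]" "\<kappa> \<noteq> 0" by (auto simp: is_unit_poly_iff)
  then show thesis using that ab by blast
qed

text \<open>
  Everything is read off from \<open>\<phi>(x)\<^sup>n \<phi>(y) = \<phi>(z) (\<phi>(z) + h(\<phi>(x)))\<close>, where \<open>\<phi>(y)\<close> is a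
  combination of \<open>1, z, y\<close> over \<open>k[x]\<close>. Multiplied by \<open>x\<^sup>n\<close> it becomes an identity between
  polynomials of degree at most \<open>2\<close> in \<open>z\<close> over \<open>k[x]\<close>.
\<close>

theorem automorphism_normal_form:
  assumes pair: "inverse_pair \<phi> \<psi>"
  obtains \<mu> g where "\<mu> \<noteq> 0" and "pcompose h [:0, \<mu>:] = h" and "\<phi> XX = emb [:0, \<mu>:]"
    and "\<phi> ZZ = ZZ + emb ([:0, 1:] ^ n * g) \<or> \<phi> ZZ = - ZZ - emb h + emb ([:0, 1:] ^ n * g)"
proof -
  from pair have \<phi>: "endo \<phi>" by (auto simp: inverse_pair_def)
  obtain \<nu> \<mu> where \<mu>: "\<mu> \<noteq> 0" and X: "\<phi> XX = emb [:\<nu>, \<mu>:]" by (rule automorphism_X_affine[OF pair])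
  obtain a \<kappa> where \<kappa>: "\<kappa> \<noteq> 0" and Z: "\<phi> ZZ = emb a + emb [:\<kappa>:] * ZZ" by (rule automorphism_Z_affine[OF pair])
  define p x where "p = [:\<nu>, \<mu>:]" and "x = ([:0, 1:] :: 'a poly)"
  define h' where "h' = pcompose h p"
  have p: "\<phi> XX = emb p" by (simp add: X p_def)
  note e = endo_add[OF \<phi>] endo_mult[OF \<phi>] endo_power[OF \<phi>] endo_emb[OF \<phi> p]
  have "\<phi> (XX ^ n * YY) = \<phi> (ZZ * (ZZ + emb h))" unfolding relation ..
  then have rel: "emb p ^ n * \<phi> YY = \<phi> ZZ * (\<phi> ZZ + emb h')"
    by (simp add: e p h'_def del: mult_pCons_left mult_pCons_right)
  have dY: "Polynomial.degree (\<phi> YY) = 2" and Ynz: "\<phi> YY \<noteq> 0"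
  proof -
    have "Polynomial.degree (\<phi> YY) = Polynomial.degree YY * Polynomial.degree (\<phi> ZZ)"
      by (rule degree_automorphism[OF \<phi> p]) (use \<mu> automorphism_degree_Z[OF pair] in \<open>auto simp: p_def\<close>)
    then show "Polynomial.degree (\<phi> YY) = 2"
      using automorphism_degree_Z[OF pair] by (simp add: YY_def)
    then show "\<phi> YY \<noteq> 0" by auto
  qed
  obtain c where "\<phi> YY = (\<Sum>k\<le>Polynomial.degree (\<phi> YY). emb (c k) * basis k)"
    by (rule A_normal_form_degree[OF endo_closed[OF \<phi> A_Y] Ynz])
  then have Y: "\<phi> YY = emb (c 0) + emb (c 1) * ZZ + emb (c 2) * YY"
    unfolding dY by (simp add: basis_def numeral_2_eq_2 del: mult_pCons_left mult_pCons_right)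
  have xn: "XX ^ n = emb (x ^ n)" by (simp add: x_def emb_simps emb_X)
  have "emb p ^ n * (emb (c 0) * XX ^ n + emb (c 1) * XX ^ n * ZZ + emb (c 2) * (XX ^ n * YY))
      = XX ^ n * (emb p ^ n * \<phi> YY)"
    unfolding Y by (simp only: algebra_simps)
  also have "\<dots> = XX ^ n * ((emb a + emb [:\<kappa>:] * ZZ) * (emb a + emb [:\<kappa>:] * ZZ + emb h'))"
    unfolding rel Z ..
  finally have "emb (p ^ n * (c 0 * x ^ n)) + emb (p ^ n * (c 1 * x ^ n + c 2 * h)) * ZZ + emb (p ^ n * c 2) * ZZ ^ 2
      = emb (x ^ n * (a * (a + h'))) + emb (x ^ n * (2 * a * [:\<kappa>:] + [:\<kappa>:] * h')) * ZZ
        + emb (x ^ n * ([:\<kappa>:] * [:\<kappa>:])) * ZZ ^ 2"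
    unfolding relation unfolding xn
    by (simp only: emb_simps algebra_simps power2_eq_square mult_2 mult_2_right)
  note c = emb_independent[OF this]
  \<comment> \<open>The coefficient of \<open>z\<^sup>2\<close> shows that \<open>\<mu> x + \<nu>\<close> divides a unit times \<open>x\<^sup>n\<close>.\<close>
  have \<nu>: "\<nu> = 0"
  proof (rule ccontr)
    assume "\<nu> \<noteq> 0"
    have "poly (p ^ n * c 2) (- \<nu> / \<mu>) = 0" using \<mu> n2 by (simp add: p_def)
    moreover have "poly (x ^ n * ([:\<kappa>:] * [:\<kappa>:])) (- \<nu> / \<mu>) \<noteq> 0"
      using \<mu> \<kappa> \<open>\<nu> \<noteq> 0\<close> by (simp add: x_def)
    ultimately show False using c(3) by simp
  qed
  have "p = [:\<mu>:] * x" by (simp add: p_def x_def \<nu>)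
  then have pn: "p ^ n = x ^ n * [:\<mu>:] ^ n" by (simp only: power_mult_distrib mult.commute)
  have xnz: "x ^ n \<noteq> 0" by (simp add: x_def)
  have c2: "[:\<mu>:] ^ n * c 2 = [:\<kappa>:] * [:\<kappa>:]"
    using c(3) unfolding pn mult.assoc by (rule mult_left_cancel[OF xnz, THEN iffD1])
  have "[:\<mu>:] ^ n * (c 1 * x ^ n + c 2 * h) = 2 * a * [:\<kappa>:] + [:\<kappa>:] * h'"
    using c(2) unfolding pn mult.assoc by (rule mult_left_cancel[OF xnz, THEN iffD1])
  then have "2 * a * [:\<kappa>:] + [:\<kappa>:] * h' - [:\<kappa>:] * [:\<kappa>:] * h = x ^ n * ([:\<mu>:] ^ n * c 1)"
    unfolding c2[symmetric] by (simp only: algebra_simps) 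
  then have dvd1: "x ^ n dvd 2 * a * [:\<kappa>:] + [:\<kappa>:] * h' - [:\<kappa>:] * [:\<kappa>:] * h" by (metis dvd_triv_left)
  have "[:\<mu>:] ^ n * (c 0 * x ^ n) = a * (a + h')"
    using c(1) unfolding pn mult.assoc by (rule mult_left_cancel[OF xnz, THEN iffD1])
  then have dvd0: "x ^ n dvd a * (a + h')" by (metis dvd_triv_right mult.assoc)
  have h'0: "poly h' 0 = poly h 0" by (simp add: h'_def p_def \<nu> poly_pcompose)
  have deg_h': "Polynomial.degree h' < n"
    using deg_h \<mu> by (simp add: h'_def p_def degree_pcompose)
  \<comment> \<open>Proportionality of \<open>h(\<mu> x)\<close> and \<open>h\<close> is equality, as both have the same value at \<open>0\<close>.\<close>
  have scalar: "c = 1 \<and> h' = h" if "h' = smult c h" for c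
  proof -
    have "poly h 0 = c * poly h 0" using h'0 that by simp
    then show ?thesis using that h0 by simp
  qed
  note finish = that
  have result: thesis if "h' = h" "\<phi> ZZ = ZZ + emb (x ^ n * g) \<or> \<phi> ZZ = - ZZ - emb h + emb (x ^ n * g)" for g
    by (rule finish[of \<mu> g]) (use that \<mu> X \<nu> in \<open>auto simp: h'_def p_def x_def\<close>)
  show thesis
  proof (cases "poly a 0 = 0")
    case True
    then have "poly (a + h') 0 \<noteq> 0" using h'0 h0 by simp
    with dvd0 have "x ^ n dvd a" unfolding x_def by (rule X_power_dvd_mult_cancel)
    then obtain g where g: "a = x ^ n * g" by (rule dvdE)
    have "2 * (x ^ n * g) * K + K * h' - K * K * h - x ^ n * (2 * g * K) = K * h' - K * K * h" for K
      by (simp add: algebra_simps)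
    with dvd_diff[OF dvd1 dvd_triv_left[of "x ^ n" "2 * g * [:\<kappa>:]"]]
    have "x ^ n dvd [:\<kappa>:] * h' - [:\<kappa>:] * [:\<kappa>:] * h"
      unfolding g by metis
    then have "[:\<kappa>:] * h' - [:\<kappa>:] * [:\<kappa>:] * h = 0"
      unfolding x_def by (rule X_power_dvd_imp_zero) (use deg_h deg_h' in \<open>auto intro!: degree_diff_less simp: \<kappa>\<close>)
    then have sm: "smult \<kappa> h' = smult \<kappa> (smult \<kappa> h)" by simp
    have "h' = smult \<kappa> h" by (rule smult_left_cancel[OF \<kappa> sm])
    then have "\<kappa> = 1" "h' = h" using scalar by blast+
    then show thesis using result[of g] Z g by (simp add: emb_simps add.commute flip: one_pCons)
  next
    case False
    have "x ^ n dvd (a + h') * a" using dvd0 by (simp only: mult.commute)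
    then have "x ^ n dvd a + h'" using False unfolding x_def by (rule X_power_dvd_mult_cancel)
    then obtain g where g: "a + h' = x ^ n * g" by (rule dvdE)
    then have a: "a = x ^ n * g - h'" by (simp add: algebra_simps)
    have "x ^ n * (2 * g * K) - (2 * (x ^ n * g - h') * K + K * h' - K * K * h) = K * h' + K * K * h" for K
      unfolding mult_2 by (simp only: algebra_simps)
    with dvd_diff[OF dvd_triv_left[of "x ^ n" "2 * g * [:\<kappa>:]"] dvd1]
    have "x ^ n dvd [:\<kappa>:] * h' + [:\<kappa>:] * [:\<kappa>:] * h"
      unfolding a by metis
    then have "[:\<kappa>:] * h' + [:\<kappa>:] * [:\<kappa>:] * h = 0"
      unfolding x_def by (rule X_power_dvd_imp_zero) (use deg_h deg_h' in \<open>auto intro!: degree_add_less simp: \<kappa>\<close>)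
    then have sm: "smult \<kappa> h' = smult \<kappa> (smult (- \<kappa>) h)" by (simp add: add_eq_0_iff2)
    have "h' = smult (- \<kappa>) h" by (rule smult_left_cancel[OF \<kappa> sm])
    then have \<kappa>1: "\<kappa> = - 1" and hh: "h' = h"
      using scalar[of "- \<kappa>"] by (auto simp: minus_equation_iff)
    have m1: "emb [:- 1:] = - 1" by (metis emb_simps(1,5) minus_pCons minus_zero one_pCons)
    have "\<phi> ZZ = emb (x ^ n * g - h) + - 1 * ZZ" unfolding Z a \<kappa>1 hh m1 ..
    also have "\<dots> = - ZZ - emb h + emb (x ^ n * g)"
      by (simp only: emb_simps) (simp del: mult_pCons_left mult_pCons_right)
    finally show thesis using result[OF hh] by blast
  qed
qed

end

section \<open>Admissible scalars\<close>

text \<open>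
  For the converse, \<open>m\<close> is the multiplicative order of \<open>\<mu>\<close>, or \<open>0\<close> if \<open>\<mu>\<close> has infinite order: then
  \<open>m\<close> divides exactly the exponents \<open>i\<close> with \<open>\<mu>\<^sup>i = 1\<close>, and these include all exponents that
  occur in \<open>h\<close>.
\<close>

lemma admissible_iff:
  fixes h :: "'a::field poly"
  shows "admissible h \<mu> \<longleftrightarrow> \<mu> \<noteq> 0 \<and> pcompose h [:0, \<mu>:] = h"
proof
  assume "admissible h \<mu>"
  then obtain m h1 where "\<mu> \<noteq> 0" and h: "h = pcompose h1 (Polynomial.monom 1 m)" and m: "\<mu> ^ m = 1"
    by (auto simp: admissible_def)
  have "pcompose (Polynomial.monom 1 m) [:0, \<mu>:] = Polynomial.monom 1 m"
    by (rule poly_eqI) (auto simp: coeff_pcompose_linear m)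
  then show "\<mu> \<noteq> 0 \<and> pcompose h [:0, \<mu>:] = h"
    using \<open>\<mu> \<noteq> 0\<close> by (simp add: h flip: pcompose_assoc)
next
  assume asm: "\<mu> \<noteq> 0 \<and> pcompose h [:0, \<mu>:] = h"
  have root: "\<mu> ^ i = 1" if "coeff h i \<noteq> 0" for i
  proof -
    have "coeff (pcompose h [:0, \<mu>:]) i = coeff h i" using asm by simp
    then show ?thesis using that by (simp add: coeff_pcompose_linear)
  qed
  obtain m where m: "\<mu> ^ m = 1" and dvd: "\<And>i. \<mu> ^ i = 1 \<Longrightarrow> m dvd i"
  proof (cases "\<exists>k>0. \<mu> ^ k = 1")
    case True
    define m where "m = (LEAST k. 0 < k \<and> \<mu> ^ k = 1)"
    have m: "0 < m" "\<mu> ^ m = 1" unfolding m_def using LeastI_ex[OF True] by auto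
    have "m dvd i" if "\<mu> ^ i = 1" for i
    proof (rule ccontr)
      assume "\<not> m dvd i"
      then have "0 < i mod m" by (simp add: mod_greater_zero_iff_not_dvd)
      moreover have "\<mu> ^ i = \<mu> ^ (m * (i div m) + i mod m)" by simp
      then have "\<mu> ^ (i mod m) = 1" using that m(2) by (simp only: power_add power_mult power_one mult_1_left)
      ultimately have "(LEAST k. 0 < k \<and> \<mu> ^ k = 1) \<le> i mod m" by (intro Least_le conjI)
      then have "m \<le> i mod m" by (simp only: m_def[symmetric])
      then show False using mod_less_divisor[OF m(1), of i] by linarith
    qed
    then show thesis using that m by blast
  next
    case False
    then show thesis using that[of 0] by (metis dvd_0_right gr0I power_0)
  qed
  define h1 where "h1 = (\<Sum>i\<le>Polynomial.degree h. Polynomial.monom (coeff h i) (i div m))"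
  have pc: "pcompose (Polynomial.monom c k) (Polynomial.monom 1 m) = Polynomial.monom c (m * k)" for c :: 'a and k
    by (induction k) (simp_all add: monom_Suc pcompose_pCons mult_monom monom_0)
  have "pcompose h1 (Polynomial.monom 1 m) = (\<Sum>i\<le>Polynomial.degree h. Polynomial.monom (coeff h i) i)"
    unfolding h1_def pcompose_sum
  proof (rule sum.cong[OF refl])
    fix i
    show "pcompose (Polynomial.monom (coeff h i) (i div m)) (Polynomial.monom 1 m) = Polynomial.monom (coeff h i) i"
    proof (cases "coeff h i = 0")
      case False
      then have "m * (i div m) = i" using dvd root by simp
      then show ?thesis unfolding pc by simp
    qed simp
  qed
  also have "\<dots> = h" by (rule poly_as_sum_of_monoms)
  finally show "admissible h \<mu>" using asm m unfolding admissible_def by metis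
qed

section \<open>Transfer to the quotient ring\<close>

context danielewski
begin

abbreviation S where "S \<equiv> carrier (ringR n h)"
abbreviation C where "C \<equiv> cls n h"
abbreviation G where "G \<equiv> AutR n h"

lemma kXYZ_simps: "carrier kXYZ = UNIV" "p \<otimes>\<^bsub>kXYZ\<^esub> q = p * q" "p \<oplus>\<^bsub>kXYZ\<^esub> q = p + q"
  "\<one>\<^bsub>kXYZ\<^esub> = 1"
  by (simp_all add: kXYZ_def ring_of_type_algebra_def)

text \<open>
  The cosets are the fibres of \<open>\<iota>\<close>; this is the isomorphism between \<open>R\<close> and \<open>A\<close>.
\<close>

lemma cls_eq_fibre: "C P = {Q. \<iota> Q = \<iota> P}"
proof -
  have "C P = {rel * Q + P |Q. True}"
    unfolding cls_def relI_def a_r_coset_def' cgenideal_def kXYZ_simps rel_def[symmetric]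
    by (auto simp: mult.commute)
  also have "\<dots> = {Q. \<iota> Q = \<iota> P}"
  proof (intro equalityI subsetI)
    fix Q assume "Q \<in> {Q. \<iota> Q = \<iota> P}"
    then have "\<iota> (Q - P) = 0" by (simp add: \<iota>_simps)
    then obtain T where "Q - P = rel * T" using \<iota>_eq_0 by blast
    then have "Q = rel * T + P" by (simp add: algebra_simps)
    then show "Q \<in> {rel * Q + P |Q. True}" by blast
  qed (auto simp: \<iota>_simps \<iota>_rel)
  finally show ?thesis .
qed

lemma cls_eq_iff: "C P = C Q \<longleftrightarrow> \<iota> P = \<iota> Q"
  unfolding cls_eq_fibre by auto

lemma carrier_eq: "S = range C"
  unfolding ringR_def FactRing_def cls_def by (auto simp: A_RCOSETS_def' kXYZ_simps)

lemma
  shows cls_mult: "C P \<otimes>\<^bsub>ringR n h\<^esub> C Q = C (P * Q)"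
    and cls_add: "C P \<oplus>\<^bsub>ringR n h\<^esub> C Q = C (P + Q)"
    and cls_one: "\<one>\<^bsub>ringR n h\<^esub> = C 1"
proof -
  interpret ideal "relI n h" kXYZ by (rule ideal_relI)
  show "C P \<otimes>\<^bsub>ringR n h\<^esub> C Q = C (P * Q)"
    using rcoset_mult_add[of P Q] by (simp add: ringR_def FactRing_def cls_def kXYZ_simps)
  show "C P \<oplus>\<^bsub>ringR n h\<^esub> C Q = C (P + Q)"
    using a_rcos_sum[of P Q] by (simp add: ringR_def FactRing_def cls_def kXYZ_simps)
  show "\<one>\<^bsub>ringR n h\<^esub> = C 1"
    by (simp add: ringR_def FactRing_def cls_def kXYZ_simps)
qed

definition val :: "'a poly poly poly set \<Rightarrow> 'a fls poly" where
  "val K = \<iota> (SOME P. P \<in> K)"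

text \<open>
  The map on \<open>A\<close> that corresponds to \<open>\<phi>\<close>: the fibre of \<open>\<iota>\<close> over \<open>r\<close> is the coset represented by \<open>r\<close>.
\<close>

definition model :: "('a poly poly poly set \<Rightarrow> 'a poly poly poly set) \<Rightarrow> 'a fls poly \<Rightarrow> 'a fls poly" where
  "model \<phi> r = val (\<phi> {P. \<iota> P = r})"

lemma val_cls: "val (C P) = \<iota> P"
proof -
  have "(SOME Q. Q \<in> C P) \<in> C P" by (rule someI[of _ P]) (simp add: cls_eq_fibre)
  then show ?thesis unfolding val_def by (simp add: cls_eq_fibre)
qed

lemma model_\<iota>: "model \<phi> (\<iota> P) = val (\<phi> (C P))"
  by (simp add: model_def cls_eq_fibre)

lemma carrier_AutR: "carrier G = algAut n h"
  by (simp add: AutR_def)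

lemma aut_maps: "\<phi> \<in> carrier G \<Longrightarrow> \<exists>Q. \<phi> (C P) = C Q"
proof -
  assume "\<phi> \<in> carrier G"
  then have "bij_betw \<phi> S S" by (simp add: carrier_AutR algAut_def Bij_def)
  then have "\<phi> (C P) \<in> S" by (rule bij_betw_apply) (rule cls_closed)
  then show ?thesis by (simp add: carrier_eq image_iff)
qed

lemma model_eq_iff: "\<phi> \<in> carrier G \<Longrightarrow> model \<phi> (\<iota> P) = \<iota> Q \<longleftrightarrow> \<phi> (C P) = C Q"
proof -
  assume "\<phi> \<in> carrier G"
  then obtain R where R: "\<phi> (C P) = C R" using aut_maps by blast
  show ?thesis by (simp only: model_\<iota> R val_cls cls_eq_iff)
qed

lemma model_obtain:
  assumes "\<phi> \<in> carrier G"
  obtains Q where "\<phi> (C P) = C Q" and "model \<phi> (\<iota> P) = \<iota> Q"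
  using aut_maps[OF assms, of P] model_eq_iff[OF assms] by blast

lemma endo_model:
  assumes \<phi>: "\<phi> \<in> carrier G"
  shows "endo (model \<phi>)"
  unfolding endo_def
proof (intro conjI ballI allI)
  have hom: "\<phi> \<in> ring_hom (ringR n h) (ringR n h)" and c: "\<phi> (C (const3 c)) = C (const3 c)" for c
    using \<phi> by (auto simp: carrier_AutR algAut_def)
  show "model \<phi> r \<in> A" if r: "r \<in> A" for r
  proof -
    obtain P where P: "r = \<iota> P" using r by (auto simp: A_def)
    obtain Q where "model \<phi> (\<iota> P) = \<iota> Q" using model_obtain[OF \<phi>, of P] by blast
    then show ?thesis by (simp add: P A_def)
  qed
  show "model \<phi> (emb [:c:]) = emb [:c:]" for c
    using c[of c] model_eq_iff[OF \<phi>, of "const3 c" "const3 c"] by (simp add: \<iota>_const3)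
  fix r s assume "r \<in> A" "s \<in> A"
  then obtain P Q where r: "r = \<iota> P" and s: "s = \<iota> Q" by (auto simp: A_def)
  obtain P' where P': "\<phi> (C P) = C P'" "model \<phi> (\<iota> P) = \<iota> P'" by (rule model_obtain[OF \<phi>])
  obtain Q' where Q': "\<phi> (C Q) = C Q'" "model \<phi> (\<iota> Q) = \<iota> Q'" by (rule model_obtain[OF \<phi>])
  have "\<phi> (C (P + Q)) = C (P' + Q')"
    using ring_hom_add[OF hom cls_closed cls_closed, of P Q] by (simp add: cls_add P' Q')
  then show "model \<phi> (r + s) = model \<phi> r + model \<phi> s"
    using model_eq_iff[OF \<phi>, of "P + Q" "P' + Q'"] P' Q' by (simp add: r s \<iota>_simps)
  have "\<phi> (C (P * Q)) = C (P' * Q')"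
    using ring_hom_mult[OF hom cls_closed cls_closed, of P Q] by (simp add: cls_mult P' Q')
  then show "model \<phi> (r * s) = model \<phi> r * model \<phi> s"
    using model_eq_iff[OF \<phi>, of "P * Q" "P' * Q'"] P' Q' by (simp add: r s \<iota>_simps)
qed

lemma mult_closed: "\<phi> \<in> carrier G \<Longrightarrow> \<psi> \<in> carrier G \<Longrightarrow> \<phi> \<otimes>\<^bsub>G\<^esub> \<psi> \<in> carrier G"
  by (rule monoid.m_closed[OF group.is_monoid[OF group_AutR]])

lemma mult_apply:
  assumes "\<phi> \<in> carrier G" and "\<psi> \<in> carrier G"
  shows "(\<phi> \<otimes>\<^bsub>G\<^esub> \<psi>) (C P) = \<phi> (\<psi> (C P))"
  using assms cls_closed[of n h P]
  by (simp add: AutR_def BijGroup_def algAut_def compose_eq)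

lemma model_mult:
  assumes \<phi>: "\<phi> \<in> carrier G" and \<psi>: "\<psi> \<in> carrier G" and "r \<in> A"
  shows "model (\<phi> \<otimes>\<^bsub>G\<^esub> \<psi>) r = model \<phi> (model \<psi> r)"
proof -
  obtain P where r: "r = \<iota> P" using assms(3) by (auto simp: A_def)
  obtain Q where "\<psi> (C P) = C Q" "model \<psi> (\<iota> P) = \<iota> Q" by (rule model_obtain[OF \<psi>])
  then show ?thesis by (simp add: r model_\<iota> mult_apply[OF \<phi> \<psi>])
qed

lemma model_one: "r \<in> A \<Longrightarrow> model \<one>\<^bsub>G\<^esub> r = r"
  by (auto simp: A_def model_\<iota> AutR_def BijGroup_def cls_closed val_cls)

lemma inverse_pair_model:
  assumes \<phi>: "\<phi> \<in> carrier G"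
  shows "inverse_pair (model \<phi>) (model (inv\<^bsub>G\<^esub> \<phi>))"
proof -
  interpret group G by (rule group_AutR)
  show ?thesis
    unfolding inverse_pair_def
    using \<phi> by (auto simp: endo_model model_one simp flip: model_mult)
qed

text \<open>
  The relation determines \<open>x\<^sup>n y\<close>, and so the value at \<open>y\<close>, because \<open>\<phi>(x)\<^sup>n\<close> can be cancelled.
\<close>

lemma aut_eqI:
  assumes \<phi>: "\<phi> \<in> carrier G" and \<psi>: "\<psi> \<in> carrier G"
    and X: "model \<phi> XX = model \<psi> XX" and Z: "model \<phi> ZZ = model \<psi> ZZ"
  shows "\<phi> = \<psi>"
proof -
  note e1 = endo_add[OF endo_model[OF \<phi>]] endo_mult[OF endo_model[OF \<phi>]]
    endo_power[OF endo_model[OF \<phi>]]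
  note e2 = endo_add[OF endo_model[OF \<psi>]] endo_mult[OF endo_model[OF \<psi>]]
    endo_power[OF endo_model[OF \<psi>]]
  obtain \<nu> \<mu> where \<mu>: "\<mu> \<noteq> 0" "model \<phi> XX = emb [:\<nu>, \<mu>:]"
    by (rule automorphism_X_affine[OF inverse_pair_model[OF \<phi>]])
  have emb: "model \<phi> (emb q) = model \<psi> (emb q)" for q
    using endo_emb[OF endo_model[OF \<phi>] \<mu>(2)] endo_emb[OF endo_model[OF \<psi>]] X \<mu>(2) by metis
  have nz: "model \<psi> XX ^ n \<noteq> 0" using \<mu> X by (metis emb_eq_0_iff pCons_eq_0_iff power_not_zero)
  have "model \<phi> (XX ^ n * YY) = model \<psi> (XX ^ n * YY)"
    unfolding relation by (simp add: e1 e2 Z emb del: mult_pCons_left mult_pCons_right)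
  then have "model \<psi> XX ^ n * model \<phi> YY = model \<psi> XX ^ n * model \<psi> YY"
    by (simp add: e1 e2 X del: mult_pCons_left mult_pCons_right)
  then have Y: "model \<phi> YY = model \<psi> YY" by (rule mult_left_cancel[OF nz, THEN iffD1])
  have eq: "model \<phi> r = model \<psi> r" if "r \<in> A" for r
    using that by (induction rule: A_induct) (auto simp: X Y Z emb e1 e2)
  have "\<phi> K = \<psi> K" if K: "K \<in> S" for K
  proof -
    obtain P where P: "K = C P" using K by (auto simp: carrier_eq)
    have "\<iota> P \<in> A" by (simp add: A_def)
    then show ?thesis
      unfolding P using eq model_obtain[OF \<phi>] model_eq_iff[OF \<psi>] by metis
  qed
  moreover have "\<phi> \<in> extensional S" "\<psi> \<in> extensional S"
    using \<phi> \<psi> by (auto simp: carrier_AutR algAut_def Bij_def)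
  ultimately show ?thesis by (intro extensionalityI)
qed

lemma is_aut_with_iff:
  "is_aut_with n h \<phi> p q r \<longleftrightarrow> \<phi> \<in> carrier G \<and> model \<phi> XX = \<iota> p \<and> model \<phi> YY = \<iota> q \<and> model \<phi> ZZ = \<iota> r"
  unfolding is_aut_with_def \<iota>_varX[symmetric] \<iota>_varY[symmetric] \<iota>_varZ[symmetric]
  using model_eq_iff by blast

section \<open>The generating automorphisms\<close>

definition substitute :: "'a poly poly poly \<Rightarrow> 'a poly poly poly \<Rightarrow> 'a poly poly poly \<Rightarrow> 'a poly poly poly \<Rightarrow> 'a poly poly poly" where
  "substitute p q r = peval (peval (peval const3 p) q) r"

lemma is_hom_polyX: "is_hom (polyX :: 'a poly \<Rightarrow> _)"
  unfolding polyX_def by (rule is_hom_comp[OF is_hom_const_poly is_hom_const_poly])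

lemma is_hom_const3: "is_hom (const3 :: 'a \<Rightarrow> _)"
  unfolding const3_def by (rule is_hom_comp[OF is_hom_const_poly is_hom_polyX])

lemma is_hom_substitute: "is_hom (substitute p q r)"
  unfolding substitute_def by (intro is_hom_peval is_hom_const3)

lemma
  shows subst_const: "substitute p q r (const3 c) = const3 c" and subst_X: "substitute p q r varX = p"
    and subst_Y: "substitute p q r varY = q" and subst_Z: "substitute p q r varZ = r"
proof -
  note i = is_hom_peval[OF is_hom_const3] is_hom_peval[OF is_hom_peval[OF is_hom_const3]]
  have c: "const3 c = [:[:[:c:]:]:]" by (simp add: const3_def polyX_def)
  have "substitute p q r [:[:[:c:]:]:] = const3 c" by (simp add: substitute_def peval_const i is_hom_const3)
  then show "substitute p q r (const3 c) = const3 c" by (simp only: c)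
  show "substitute p q r varX = p" "substitute p q r varY = q" "substitute p q r varZ = r"
    by (simp_all add: substitute_def varX_def varY_def varZ_def polyX_def peval_const peval_X i is_hom_const3)
qed

lemma subst_polyX: "substitute (polyX u) q r (polyX g) = polyX (pcompose g u)"
proof -
  have 1: "is_hom (\<lambda>g. pcompose g u)"
    by (rule is_homI) (simp_all add: pcompose_add pcompose_mult pcompose_1)
  show ?thesis
  proof (rule poly_hom_ext[OF is_hom_comp[OF is_hom_polyX is_hom_substitute] is_hom_comp[OF 1 is_hom_polyX]])
    show "substitute (polyX u) q r (polyX [:c:]) = polyX (pcompose [:c:] u)" for c
      using subst_const[of "polyX u" q r c] by (simp add: const3_def)
    show "substitute (polyX u) q r (polyX [:0, 1:]) = polyX (pcompose [:0, 1:] u)"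
      using subst_X[of "polyX u" q r] by (simp add: varX_def pcompose_pCons)
  qed
qed

text \<open>
  A substitution that respects the relation acts on cosets; it is bijective there if some other
  substitution is inverse to it on the three generators.
\<close>

lemma automorphism_exists:
  assumes rel1: "\<iota> (substitute p q r rel) = 0" and rel2: "\<iota> (substitute p' q' r' rel) = 0"
    and inv1: "\<iota> (substitute p q r p') = XX" "\<iota> (substitute p q r q') = YY" "\<iota> (substitute p q r r') = ZZ"
    and inv2: "\<iota> (substitute p' q' r' p) = XX" "\<iota> (substitute p' q' r' q) = YY" "\<iota> (substitute p' q' r' r) = ZZ"
  shows "\<exists>\<phi>. is_aut_with n h \<phi> p q r"
proof -
  define F where "F p q r K = (if K \<in> S then C (substitute p q r (SOME P. P \<in> K)) else undefined)" for p q r K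
  have F: "F p q r (C P) = C (substitute p q r P)" if "\<iota> (substitute p q r rel) = 0" for p q r P
  proof -
    have "(SOME Q. Q \<in> C P) \<in> C P" by (rule someI[of _ P]) (simp add: cls_eq_fibre)
    then have "\<iota> ((SOME Q. Q \<in> C P) - P) = 0" by (simp add: cls_eq_fibre \<iota>_simps)
    then obtain T where "(SOME Q. Q \<in> C P) - P = rel * T" using \<iota>_eq_0 by blast
    then have "(SOME Q. Q \<in> C P) = P + rel * T" by (simp add: algebra_simps)
    then show ?thesis
      using that cls_closed[of n h P]
      by (simp add: F_def cls_eq_iff hom_simps[OF is_hom_substitute] \<iota>_simps)
  qed
  have inverse: "F p' q' r' (F p q r (C P)) = C P"
    if "\<iota> (substitute p q r rel) = 0" "\<iota> (substitute p' q' r' rel) = 0"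
      "\<iota> (substitute p' q' r' p) = XX" "\<iota> (substitute p' q' r' q) = YY" "\<iota> (substitute p' q' r' r) = ZZ"
    for p q r p' q' r' P
  proof -
    have "\<iota> (substitute p' q' r' (substitute p q r P)) = \<iota> P"
      by (rule poly3_hom_ext[OF is_hom_comp[OF is_hom_comp[OF is_hom_substitute is_hom_substitute] is_hom_\<iota>] is_hom_\<iota>])
        (simp_all add: subst_const subst_X subst_Y subst_Z that \<iota>_varX \<iota>_varY \<iota>_varZ)
    then show ?thesis by (simp add: F that cls_eq_iff)
  qed
  let ?f = "F p q r" and ?g = "F p' q' r'"
  have "bij_betw ?f S S"
  proof (rule bij_betw_byWitness[where f' = ?g])
    show "\<forall>K\<in>S. ?g (?f K) = K" "\<forall>K\<in>S. ?f (?g K) = K"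
      unfolding carrier_eq by (simp_all add: inverse assms)
    show "?f ` S \<subseteq> S" "?g ` S \<subseteq> S"
      unfolding carrier_eq by (simp_all add: image_subset_iff F rel1 rel2)
  qed
  moreover have "?f \<in> extensional S" by (simp add: extensional_def F_def)
  moreover have "?f \<in> ring_hom (ringR n h) (ringR n h)"
    by (rule ring_hom_memI)
      (auto simp: carrier_eq F rel1 cls_add cls_mult cls_one hom_simps[OF is_hom_substitute])
  ultimately have "?f \<in> carrier G"
    by (simp add: carrier_AutR algAut_def Bij_def F rel1 subst_const)
  then show ?thesis
    unfolding is_aut_with_def by (intro exI[of _ ?f]) (simp add: F rel1 subst_X subst_Y subst_Z)
qed

lemma is_aut_with_unique: "is_aut_with n h \<phi> p q r \<Longrightarrow> is_aut_with n h \<psi> p q r \<Longrightarrow> \<phi> = \<psi>"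
  by (auto simp: is_aut_with_iff intro: aut_eqI)

text \<open>
  All substitutions in question send \<open>X\<close> to a polynomial in \<open>X\<close> alone.
\<close>

lemma \<iota>_subst_rel:
  "\<iota> (substitute (polyX u) q r rel) = emb u ^ n * \<iota> q - \<iota> r * (\<iota> r + emb (pcompose h u))"
  by (simp add: rel_def hom_simps[OF is_hom_substitute] subst_X subst_Y subst_Z subst_polyX \<iota>_simps \<iota>_polyX
      power2_eq_square algebra_simps)

lemmas \<iota>_vars = \<iota>_varX \<iota>_varY \<iota>_varZ \<iota>_polyX
lemmas subst_vars = hom_simps[OF is_hom_substitute] subst_X subst_Y subst_Z

text \<open>
  The inverse of \<open>E\<^sub>f\<close> is \<open>E\<^sub>-\<^sub>f\<close>.
\<close>

lemma E_exists: "\<exists>!\<phi>. is_E n h f \<phi>"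
proof -
  define q :: "'a poly \<Rightarrow> 'a poly poly poly"
    where "q f = varY + 2 * polyX f * varZ + varX ^ n * polyX f ^ 2 + polyX f * polyX h" for f
  define r :: "'a poly \<Rightarrow> 'a poly poly poly" where "r f = varZ + varX ^ n * polyX f" for f
  have X: "varX = polyX [:0, 1:]" by (simp add: varX_def)
  have sub: "substitute varX q' r' (polyX g) = polyX g" for q' r' g
    unfolding X subst_polyX by simp
  have \<iota>q: "\<iota> (q f) = YY + 2 * emb f * ZZ + XX ^ n * emb f ^ 2 + emb f * emb h" for f
    by (simp add: q_def \<iota>_simps \<iota>_vars del: mult_pCons_left mult_pCons_right)
  have \<iota>r: "\<iota> (r f) = ZZ + XX ^ n * emb f" for f
    by (simp add: r_def \<iota>_simps \<iota>_vars del: mult_pCons_left mult_pCons_right)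
  have rel: "\<iota> (substitute varX (q f) (r f) rel) = 0" for f
  proof -
    have "XX ^ n * (YY + 2 * emb f * ZZ + XX ^ n * emb f ^ 2 + emb f * emb h)
        = ZZ * (ZZ + emb h) + XX ^ n * (2 * emb f * ZZ + XX ^ n * emb f ^ 2 + emb f * emb h)"
      unfolding relation[symmetric] by (simp only: algebra_simps)
    also have "\<dots> = (ZZ + XX ^ n * emb f) * (ZZ + XX ^ n * emb f + emb h)"
      unfolding mult_2 power2_eq_square by (simp only: algebra_simps)
    finally show ?thesis
      unfolding X \<iota>_subst_rel \<iota>q \<iota>r emb_X by simp
  qed
  have invr: "\<iota> (substitute varX (q (- f)) (r (- f)) (r f)) = ZZ" for f
    by (simp add: r_def subst_vars sub \<iota>_simps \<iota>_vars emb_simps del: mult_pCons_left mult_pCons_right)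
  have invq: "\<iota> (substitute varX (q (- f)) (r (- f)) (q f)) = YY" for f
    by (simp add: q_def r_def subst_vars sub \<iota>_simps \<iota>_vars emb_simps algebra_simps power2_eq_square
        del: mult_pCons_left mult_pCons_right)
  have "\<exists>\<phi>. is_aut_with n h \<phi> varX (q f) (r f)"
    by (rule automorphism_exists[of varX "q f" "r f" varX "q (- f)" "r (- f)"])
      (use invr[of f] invr[of "- f"] invq[of f] invq[of "- f"] rel in \<open>auto simp: subst_X \<iota>_varX\<close>)
  then show ?thesis
    unfolding is_E_def q_def r_def by (blast intro: is_aut_with_unique)
qed

text \<open>
  \<open>T\<close> exchanges the two factors of \<open>z (z + h)\<close> up to sign and is its own inverse.
\<close>

lemma T_exists: "\<exists>!\<phi>. is_T n h \<phi>"
proof -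
  have X: "varX = polyX [:0, 1:]" by (simp add: varX_def)
  have sub: "substitute varX q' r' (polyX g) = polyX g" for q' r' g
    unfolding X subst_polyX by simp
  have rel: "\<iota> (substitute varX varY (- varZ - polyX h) rel) = 0"
  proof -
    have "z * (z + k) - (- z - k) * (- z - k + k) = 0" for z k :: "'a fls poly"
      by (simp add: algebra_simps)
    then show ?thesis
      unfolding X \<iota>_subst_rel emb_X \<iota>_simps \<iota>_vars relation pcompose_idR .
  qed
  have "\<exists>\<phi>. is_aut_with n h \<phi> varX varY (- varZ - polyX h)"
    by (rule automorphism_exists[OF rel rel]) (simp_all add: subst_vars sub \<iota>_simps \<iota>_vars)
  then show ?thesis
    unfolding is_T_def by (blast intro: is_aut_with_unique)
qed

text \<open>
  The inverse of \<open>L\<^sub>\<mu>\<close> is the automorphism for \<open>\<mu>\<^sup>-\<^sup>1\<close>, which is admissible as well.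
\<close>

lemma L_exists:
  assumes "admissible h \<mu>"
  shows "\<exists>!\<phi>. is_L n h \<mu> \<phi>"
proof -
  have \<mu>: "\<mu> \<noteq> 0" and inv: "pcompose h [:0, \<mu>:] = h" using assms by (auto simp: admissible_iff)
  have inv': "pcompose h [:0, inverse \<mu>:] = h"
  proof -
    have "pcompose h [:0, inverse \<mu>:] = pcompose (pcompose h [:0, \<mu>:]) [:0, inverse \<mu>:]" by (simp add: inv)
    also have "\<dots> = h" using \<mu> by (simp add: pcompose_pCons flip: pcompose_assoc)
    finally show ?thesis .
  qed
  have X: "const3 c * varX = polyX [:0, c:]" for c :: 'a
    by (simp add: const3_def varX_def polyX_def)
  have c: "\<iota> (const3 c * P) = emb [:c:] * \<iota> P" for c P by (simp add: \<iota>_simps \<iota>_const3)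
  have lin: "emb [:0, c:] = emb [:c:] * XX" for c
  proof -
    have "[:0, c:] = [:c:] * [:0, 1:]" by simp
    then show ?thesis by (simp only: emb_simps emb_X)
  qed
  have cc: "emb [:c:] * emb [:d:] = emb [:c * d:]" for c d by (simp flip: emb_simps)
  have rel: "\<iota> (substitute (const3 c * varX) (const3 (inverse c ^ n) * varY) varZ rel) = 0"
    if "c \<noteq> 0" "pcompose h [:0, c:] = h" for c
  proof -
    have "emb [:c:] ^ n = emb [:c ^ n:]" by (simp add: poly_const_pow flip: emb_simps)
    then have "emb [:0, c:] ^ n * (emb [:inverse c ^ n:] * YY) = (emb [:c ^ n:] * emb [:inverse c ^ n:]) * (XX ^ n * YY)"
      unfolding lin by (simp only: power_mult_distrib ac_simps)
    also have "\<dots> = XX ^ n * YY"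
      unfolding cc using that by (simp add: emb_simps flip: power_mult_distrib one_pCons)
    finally show ?thesis
      unfolding X \<iota>_subst_rel c \<iota>_varY \<iota>_varZ that relation by simp
  qed
  have inv_X: "\<iota> (substitute (const3 c * varX) q r (const3 d * varX)) = XX" if "c * d = 1" for c d q r
    using that by (simp add: subst_vars subst_const \<iota>_simps \<iota>_const3 \<iota>_vars cc mult.assoc[symmetric] mult.commute[of d] emb_simps del: mult_pCons_left mult_pCons_right flip: one_pCons)
  have inv_Y: "\<iota> (substitute p (const3 c * varY) r (const3 d * varY)) = YY" if "c * d = 1" for c d p r
    using that by (simp add: subst_vars subst_const \<iota>_simps \<iota>_const3 \<iota>_vars cc mult.assoc[symmetric] mult.commute[of d] emb_simps del: mult_pCons_left mult_pCons_right flip: one_pCons)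
  have "\<exists>\<phi>. is_aut_with n h \<phi> (const3 \<mu> * varX) (const3 (inverse \<mu> ^ n) * varY) varZ"
    by (rule automorphism_exists[OF rel[OF \<mu> inv] rel[OF _ inv']])
      (use \<mu> in \<open>auto simp: subst_Z \<iota>_varZ simp flip: power_mult_distrib intro!: inv_X inv_Y\<close>)
  then show ?thesis
    unfolding is_L_def by (blast intro: is_aut_with_unique)
qed

lemma E_model:
  assumes "is_E n h f \<phi>"
  shows "\<phi> \<in> carrier G" and "model \<phi> (emb p) = emb p" and "model \<phi> ZZ = ZZ + emb ([:0, 1:] ^ n * f)"
proof -
  show \<phi>: "\<phi> \<in> carrier G" using assms by (simp add: is_E_def is_aut_with_iff)
  have X: "model \<phi> XX = emb [:0, 1:]" and Z: "model \<phi> ZZ = \<iota> (varZ + varX ^ n * polyX f)"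
    using assms by (simp_all add: is_E_def is_aut_with_iff \<iota>_varX emb_X)
  show "model \<phi> (emb p) = emb p" using endo_emb[OF endo_model[OF \<phi>] X, of p] by simp
  show "model \<phi> ZZ = ZZ + emb ([:0, 1:] ^ n * f)"
    unfolding Z by (simp only: \<iota>_simps \<iota>_vars emb_simps emb_X)
qed

lemma T_model:
  assumes "is_T n h \<phi>"
  shows "\<phi> \<in> carrier G" and "model \<phi> XX = XX" and "model \<phi> ZZ = - ZZ - emb h"
  using assms by (simp_all add: is_T_def is_aut_with_iff \<iota>_simps \<iota>_vars)

lemma L_model:
  assumes "is_L n h \<mu> \<phi>"
  shows "\<phi> \<in> carrier G" and "model \<phi> (emb p) = emb (pcompose p [:0, \<mu>:])" and "model \<phi> ZZ = ZZ"
proof -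
  show \<phi>: "\<phi> \<in> carrier G" using assms by (simp add: is_L_def is_aut_with_iff)
  have "const3 \<mu> * varX = polyX [:0, \<mu>:]" by (simp add: const3_def varX_def polyX_def)
  then have X: "model \<phi> XX = emb [:0, \<mu>:]" and Z: "model \<phi> ZZ = ZZ"
    using assms by (simp_all add: is_L_def is_aut_with_iff \<iota>_vars)
  show "model \<phi> (emb p) = emb (pcompose p [:0, \<mu>:])" using endo_emb[OF endo_model[OF \<phi>] X] .
  show "model \<phi> ZZ = ZZ" by (rule Z)
qed

text \<open>
  By \<open>automorphism_normal_form\<close>, \<open>\<phi>\<close> agrees with \<open>E\<^sub>g L\<^sub>\<mu>\<close> or with \<open>E\<^sub>-\<^sub>g L\<^sub>\<mu> T\<close> at \<open>x\<close> and
  \<open>z\<close>; the sign of \<open>g\<close> in the second case comes from \<open>T(z) = -z - h\<close>.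
\<close>

theorem aut_factorization:
  assumes \<phi>: "\<phi> \<in> carrier G"
  obtains E f L \<mu> where "is_E n h f E" and "admissible h \<mu>" and "is_L n h \<mu> L" and "\<phi> = E \<otimes>\<^bsub>G\<^esub> L"
  | E f L \<mu> T where "is_E n h f E" and "admissible h \<mu>" and "is_L n h \<mu> L" and "is_T n h T"
      and "\<phi> = E \<otimes>\<^bsub>G\<^esub> L \<otimes>\<^bsub>G\<^esub> T"
proof -
  obtain \<mu> g where \<mu>: "\<mu> \<noteq> 0" "pcompose h [:0, \<mu>:] = h" and X: "model \<phi> XX = emb [:0, \<mu>:]"
    and Z: "model \<phi> ZZ = ZZ + emb ([:0, 1:] ^ n * g) \<or> model \<phi> ZZ = - ZZ - emb h + emb ([:0, 1:] ^ n * g)"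
    by (rule automorphism_normal_form[OF inverse_pair_model[OF \<phi>]])
  have adm: "admissible h \<mu>" using \<mu> by (simp add: admissible_iff)
  obtain L where L: "is_L n h \<mu> L" using L_exists[OF adm] by blast
  obtain T where T: "is_T n h T" using T_exists by blast
  note Lm = L_model[OF L] and Tm = T_model[OF T]
  have LX: "model L XX = emb [:0, \<mu>:]" using Lm(2)[of "[:0, 1:]"] by (simp add: emb_X pcompose_pCons)
  from Z show thesis
  proof
    assume Z: "model \<phi> ZZ = ZZ + emb ([:0, 1:] ^ n * g)"
    obtain E where E: "is_E n h g E" using E_exists by blast
    note Em = E_model[OF E]
    have "\<phi> = E \<otimes>\<^bsub>G\<^esub> L"
      by (rule aut_eqI[OF \<phi> mult_closed[OF Em(1) Lm(1)]])
        (simp_all only: model_mult[OF Em(1) Lm(1)] A_X A_Z LX Em Lm X Z)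
    then show thesis using that(1) E adm L by blast
  next
    assume Z: "model \<phi> ZZ = - ZZ - emb h + emb ([:0, 1:] ^ n * g)"
    obtain E where E: "is_E n h (- g) E" using E_exists by blast
    note Em = E_model[OF E]
    note EL = mult_closed[OF Em(1) Lm(1)]
    have minus: "model \<psi> (- ZZ - emb h) = - model \<psi> ZZ - model \<psi> (emb h)" if "\<psi> \<in> carrier G" for \<psi>
      unfolding endo_diff[OF endo_model[OF that] A_uminus[OF A_Z] A_emb]
        endo_uminus[OF endo_model[OF that] A_Z] ..
    have "\<phi> = E \<otimes>\<^bsub>G\<^esub> L \<otimes>\<^bsub>G\<^esub> T"
    proof (rule aut_eqI[OF \<phi> mult_closed[OF EL Tm(1)]])
      show "model \<phi> XX = model (E \<otimes>\<^bsub>G\<^esub> L \<otimes>\<^bsub>G\<^esub> T) XX"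
        by (simp only: model_mult[OF EL Tm(1)] model_mult[OF Em(1) Lm(1)] A_X LX Em Lm Tm X)
      have "model (E \<otimes>\<^bsub>G\<^esub> L \<otimes>\<^bsub>G\<^esub> T) ZZ = model E (model L (- ZZ - emb h))"
        by (simp only: model_mult[OF EL Tm(1)] model_mult[OF Em(1) Lm(1)] A_Z A_emb A_uminus A_diff Tm)
      also have "\<dots> = - (ZZ + emb ([:0, 1:] ^ n * (- g))) - emb h"
        by (simp only: minus Em Lm \<mu>)
      also have "\<dots> = model \<phi> ZZ" unfolding Z by (simp add: emb_simps)
      finally show "model \<phi> ZZ = model (E \<otimes>\<^bsub>G\<^esub> L \<otimes>\<^bsub>G\<^esub> T) ZZ" ..
    qed
    then show thesis using that(2) E adm L T by blast
  qed
qed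

end

theorem theorem4p2:
  fixes h :: "'a::field poly" and n :: nat
  assumes "n \<ge> 2" and "poly h 0 \<noteq> 0" and "Polynomial.degree h < n"
  shows "(\<forall>f. \<exists>!\<phi>. is_E n h f \<phi>) \<and>
         (\<exists>!\<phi>. is_T n h \<phi>) \<and>
         (\<forall>\<mu>. admissible h \<mu> \<longrightarrow> (\<exists>!\<phi>. is_L n h \<mu> \<phi>)) \<and>
         generate (AutR n h)
           ({\<phi>. \<exists>f. is_E n h f \<phi>} \<union> {\<phi>. is_T n h \<phi>} \<union>
            {\<phi>. \<exists>\<mu>. admissible h \<mu> \<and> is_L n h \<mu> \<phi>})
         = carrier (AutR n h)"
proof -
  interpret danielewski n h by unfold_locales (fact assms)+
  interpret group "AutR n h" by (rule group_AutR)
  let ?gens = "{\<phi>. \<exists>f. is_E n h f \<phi>} \<union> {\<phi>. is_T n h \<phi>} \<union> {\<phi>. \<exists>\<mu>. admissible h \<mu> \<and> is_L n h \<mu> \<phi>}"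
  have "generate (AutR n h) ?gens = carrier (AutR n h)"
  proof (rule equalityI)
    show "generate (AutR n h) ?gens \<subseteq> carrier (AutR n h)"
      by (rule generate_incl) (auto simp: is_E_def is_T_def is_L_def is_aut_with_def)
    show "carrier (AutR n h) \<subseteq> generate (AutR n h) ?gens"
    proof
      fix \<phi> assume "\<phi> \<in> carrier (AutR n h)"
      then show "\<phi> \<in> generate (AutR n h) ?gens"
        by (cases rule: aut_factorization) (blast intro: generate.incl generate.eng)+
    qed
  qed
  then show ?thesis using E_exists T_exists L_exists by blast
qed

end
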